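(* There is an algorithm that, given a permutation $\pi$ of $\{1,\dots,n\}$, computes the tree-clique width $\mathrm{tcl}(G[\pi])$ of the permutation graph $G[\pi]$ in $O(n^3\log n)$ time.
   Context: For a permutation $\pi$ of $\{1,\dots,n\}$, the permutation graph $G[\pi]$ has vertex set $\{1,\dots,n\}$ and edges $ij$ with $(i-j)(\pi^{-1}_i-\pi^{-1}_j)<0$. For a graph $G$ and $X\subseteq V(G)$, $\mathrm{vcc}(X)$ is the minimum number of cliques of $G$ whose union is $X$. A tree decomposition of $G$ is a pair $(T,\{X_t\})$ with $T$ a tree and bags $X_t\subseteq V(G)$ such that every vertex lies in some bag, both endpoints of every edge lie in a common bag, and for every vertex $v$ the nodes $t$ with $v\in X_t$ induce a connected subtree. An augmented tree decomposition additionally assigns to each node $t$ a collection $C_t$ of cliques of $G$ whose union is $X_t$; its width is $\max_t|C_t|$. The tree-clique width $\mathrm{tcl}(G)$ is the minimum width of an augmented tree decomposition, i.e. the minimum over tree decompositions of $\max_t\mathrm{vcc}(X_t)$. *)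

theory Defs
  imports Complex_Main "HOL-Library.Landau_Symbols" "HOL-Combinatorics.Permutations"
begin

section \<open>Graphs\<close>

text \<open>Finite simple graphs: a vertex set \<open>V\<close> with a symmetric irreflexive adjacency relation \<open>E\<close>.
  The trees of the AFP entry \<open>Graph_Theory\<close> are digraphs without directed cycles, so they include
  orientations of graphs that do have cycles; undirected trees are therefore defined here.\<close>

definition graph :: "'a set \<Rightarrow> ('a \<times> 'a) set \<Rightarrow> bool" where
  "graph V E \<longleftrightarrow> finite V \<and> E \<subseteq> V \<times> V \<and> sym E \<and> irrefl E"

definition clique :: "'a set \<Rightarrow> ('a \<times> 'a) set \<Rightarrow> 'a set \<Rightarrow> bool" where
  "clique V E K \<longleftrightarrow> K \<subseteq> V \<and> (\<forall>u\<in>K. \<forall>v\<in>K. u \<noteq> v \<longrightarrow> (u, v) \<in> E)"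

definition vcc :: "'a set \<Rightarrow> ('a \<times> 'a) set \<Rightarrow> 'a set \<Rightarrow> nat" where
  "vcc V E X = (LEAST k. \<exists>C. finite C \<and> (\<forall>K\<in>C. clique V E K) \<and> \<Union>C = X \<and> card C = k)"

text \<open>Connectedness of the subgraph induced by \<open>S\<close>.\<close>

definition connected_on :: "('a \<times> 'a) set \<Rightarrow> 'a set \<Rightarrow> bool" where
  "connected_on E S \<longleftrightarrow> (\<forall>u\<in>S. \<forall>v\<in>S. (u, v) \<in> (E \<inter> S \<times> S)\<^sup>*)"

definition is_cycle :: "('a \<times> 'a) set \<Rightarrow> 'a list \<Rightarrow> bool" where
  "is_cycle E p \<longleftrightarrow> 3 \<le> length p \<and> distinct p \<and>
     (\<forall>i<length p. (p ! i, p ! (Suc i mod length p)) \<in> E)"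

definition tree :: "'a set \<Rightarrow> ('a \<times> 'a) set \<Rightarrow> bool" where
  "tree N F \<longleftrightarrow> graph N F \<and> N \<noteq> {} \<and> connected_on F N \<and> (\<nexists>p. is_cycle F p)"

section \<open>Tree-clique width\<close>

definition tree_decomposition ::
  "'a set \<Rightarrow> ('a \<times> 'a) set \<Rightarrow> 't set \<Rightarrow> ('t \<times> 't) set \<Rightarrow> ('t \<Rightarrow> 'a set) \<Rightarrow> bool" where
  "tree_decomposition V E N F X \<longleftrightarrow>
     tree N F \<and>
     (\<forall>t\<in>N. X t \<subseteq> V) \<and>
     (\<forall>v\<in>V. \<exists>t\<in>N. v \<in> X t) \<and>
     (\<forall>(u, v)\<in>E. \<exists>t\<in>N. u \<in> X t \<and> v \<in> X t) \<and>
     (\<forall>v\<in>V. connected_on F {t \<in> N. v \<in> X t})"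

definition augmented_tree_decomposition ::
  "'a set \<Rightarrow> ('a \<times> 'a) set \<Rightarrow> 't set \<Rightarrow> ('t \<times> 't) set \<Rightarrow> ('t \<Rightarrow> 'a set) \<Rightarrow> ('t \<Rightarrow> 'a set set) \<Rightarrow> bool"
where
  "augmented_tree_decomposition V E N F X C \<longleftrightarrow>
     tree_decomposition V E N F X \<and>
     (\<forall>t\<in>N. finite (C t) \<and> (\<forall>K\<in>C t. clique V E K) \<and> \<Union>(C t) = X t)"

definition width :: "'t set \<Rightarrow> ('t \<Rightarrow> 'a set set) \<Rightarrow> nat" where
  "width N C = Max ((\<lambda>t. card (C t)) ` N)"

text \<open>Every finite tree is isomorphic to one whose nodes are natural numbers.\<close>

definition tcl :: "'a set \<Rightarrow> ('a \<times> 'a) set \<Rightarrow> nat" where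
  "tcl V E = (LEAST k. \<exists>(N :: nat set) F X C.
     augmented_tree_decomposition V E N F X C \<and> width N C = k)"

lemma clique_cover_singletons:
  assumes "finite X" "X \<subseteq> V"
  shows "finite ((\<lambda>v. {v}) ` X) \<and> (\<forall>K\<in>(\<lambda>v. {v}) ` X. clique V E K) \<and> \<Union>((\<lambda>v. {v}) ` X) = X"
  using assms by (auto simp: clique_def)

lemma vcc_cover_exists:
  assumes "finite X" "X \<subseteq> V"
  obtains C where "finite C" "\<forall>K\<in>C. clique V E K" "\<Union>C = X" "card C = vcc V E X"
proof -
  have "\<exists>k C. finite C \<and> (\<forall>K\<in>C. clique V E K) \<and> \<Union>C = X \<and> card C = k"
    using clique_cover_singletons[OF assms, of E] by blast
  then have "\<exists>C. finite C \<and> (\<forall>K\<in>C. clique V E K) \<and> \<Union>C = X \<and> card C = vcc V E X"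
    unfolding vcc_def by (rule LeastI_ex)
  then show thesis using that by blast
qed

lemma vcc_le:
  assumes "finite C" "\<forall>K\<in>C. clique V E K" "\<Union>C = X"
  shows "vcc V E X \<le> card C"
  unfolding vcc_def by (rule Least_le) (use assms in blast)

lemma tree_singleton: "tree {t} {}"
proof -
  have "\<not> is_cycle {} p" for p :: "'a list"
    unfolding is_cycle_def by (cases p) auto
  then show ?thesis
    by (simp add: tree_def graph_def connected_on_def sym_def irrefl_def)
qed

lemma tcl_attained:
  assumes "graph V E"
  obtains N :: "nat set" and F X C
  where "augmented_tree_decomposition V E N F X C" "width N C = tcl V E"
proof -
  have "tree_decomposition V E {0::nat} {} (\<lambda>_. V)"
    using assms tree_singleton[of "0::nat"]
    by (auto simp: tree_decomposition_def graph_def connected_on_def)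
  then have "augmented_tree_decomposition V E {0::nat} {} (\<lambda>_. V) (\<lambda>_. (\<lambda>v. {v}) ` V)"
    using assms clique_cover_singletons[of V V E]
    by (simp add: augmented_tree_decomposition_def graph_def)
  then have "\<exists>k (N :: nat set) F X C. augmented_tree_decomposition V E N F X C \<and> width N C = k"
    by blast
  then have "\<exists>(N :: nat set) F X C.
      augmented_tree_decomposition V E N F X C \<and> width N C = tcl V E"
    unfolding tcl_def by (rule LeastI_ex)
  then show thesis using that by blast
qed

lemma tcl_eq_min_max_vcc:
  assumes "graph V E"
  shows "tcl V E = (LEAST k. \<exists>(N :: nat set) F X.
           tree_decomposition V E N F X \<and> Max ((\<lambda>t. vcc V E (X t)) ` N) = k)"
    (is "_ = (LEAST k. ?P k)")
proof (rule antisym)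
  obtain N :: "nat set" and F X C where
    a: "augmented_tree_decomposition V E N F X C" and w: "width N C = tcl V E"
    using tcl_attained[OF assms] .
  have td: "tree_decomposition V E N F X"
    using a by (simp add: augmented_tree_decomposition_def)
  then have N: "finite N" "N \<noteq> {}"
    by (auto simp: tree_decomposition_def tree_def graph_def)
  have "Max ((\<lambda>t. vcc V E (X t)) ` N) \<le> width N C"
    unfolding width_def
  proof (rule Max.boundedI)
    fix k assume "k \<in> (\<lambda>t. vcc V E (X t)) ` N"
    then obtain t where t: "t \<in> N" "k = vcc V E (X t)" by blast
    then have "k \<le> card (C t)"
      using a by (auto simp: augmented_tree_decomposition_def intro: vcc_le)
    also have "\<dots> \<le> Max ((\<lambda>t. card (C t)) ` N)" using N t by simp
    finally show "k \<le> Max ((\<lambda>t. card (C t)) ` N)" .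
  qed (use N in auto)
  moreover have "(LEAST k. ?P k) \<le> Max ((\<lambda>t. vcc V E (X t)) ` N)"
    by (rule Least_le) (use td in blast)
  ultimately show "(LEAST k. ?P k) \<le> tcl V E" using w by simp
  have "?P (LEAST k. ?P k)" by (rule LeastI_ex) (use td in blast)
  then obtain N :: "nat set" and F X where
    td: "tree_decomposition V E N F X" and
    m: "Max ((\<lambda>t. vcc V E (X t)) ` N) = (LEAST k. ?P k)" by blast
  have "\<exists>D. finite D \<and> (\<forall>K\<in>D. clique V E K) \<and> \<Union>D = X t \<and> card D = vcc V E (X t)"
    if "t \<in> N" for t
  proof -
    have "X t \<subseteq> V" using td that by (auto simp: tree_decomposition_def)
    moreover then have "finite (X t)" using assms finite_subset by (auto simp: graph_def)
    ultimately show ?thesis by (metis vcc_cover_exists)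
  qed
  then obtain C where C: "\<And>t. t \<in> N \<Longrightarrow>
      finite (C t) \<and> (\<forall>K\<in>C t. clique V E K) \<and> \<Union>(C t) = X t \<and> card (C t) = vcc V E (X t)"
    by metis
  have "augmented_tree_decomposition V E N F X C"
    using td C by (simp add: augmented_tree_decomposition_def)
  moreover have "width N C = (LEAST k. ?P k)"
    unfolding width_def m[symmetric] by (rule arg_cong[of _ _ Max]) (use C in force)
  ultimately show "tcl V E \<le> (LEAST k. ?P k)"
    unfolding tcl_def by (intro Least_le) blast
qed

section \<open>Permutation graphs\<close>

definition perm_graph_edges :: "nat \<Rightarrow> (nat \<Rightarrow> nat) \<Rightarrow> (nat \<times> nat) set" where
  "perm_graph_edges n \<pi> = {(i, j). i \<in> {1..n} \<and> j \<in> {1..n} \<and>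
     (int i - int j) * (int (inv \<pi> i) - int (inv \<pi> j)) < 0}"

lemma graph_perm_graph: "graph {1..n} (perm_graph_edges n \<pi>)"
  by (auto simp: graph_def perm_graph_edges_def sym_def irrefl_def algebra_simps)

section \<open>Word RAM programs\<close>

text \<open>A state consists of the registers and the memory cells, all holding natural numbers.  Programs
  are written with structured control flow instead of jumps, which changes the running time by at
  most a constant factor.  Every evaluation of an operator, operand or memory access, and
  every assignment, store and branch costs one time unit.  Truth values are \<open>0\<close> (false) and
  nonzero (true), \<open>Sub\<close> is truncated at \<open>0\<close>, and division by \<open>0\<close> yields \<open>0\<close>.\<close>

type_synonym state = "(nat \<Rightarrow> nat) \<times> (nat \<Rightarrow> nat)"

datatype binop = Add | Sub | Mul | Div | Mod | Less | Eq

datatype expr = Const nat | Reg nat | Load expr | Op binop expr expr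

datatype com =
    Skip
  | Assign nat expr
  | Store expr expr
  | Seq com com
  | Cond expr com com
  | While expr com

fun binop_val :: "binop \<Rightarrow> nat \<Rightarrow> nat \<Rightarrow> nat" where
  "binop_val Add a b = a + b"
| "binop_val Sub a b = a - b"
| "binop_val Mul a b = a * b"
| "binop_val Div a b = a div b"
| "binop_val Mod a b = a mod b"
| "binop_val Less a b = of_bool (a < b)"
| "binop_val Eq a b = of_bool (a = b)"

fun expr_val :: "expr \<Rightarrow> state \<Rightarrow> nat" where
  "expr_val (Const k) s = k"
| "expr_val (Reg r) s = fst s r"
| "expr_val (Load e) s = snd s (expr_val e s)"
| "expr_val (Op f e1 e2) s = binop_val f (expr_val e1 s) (expr_val e2 s)"

fun expr_cost :: "expr \<Rightarrow> nat" where
  "expr_cost (Const k) = 1"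
| "expr_cost (Reg r) = 1"
| "expr_cost (Load e) = 1 + expr_cost e"
| "expr_cost (Op f e1 e2) = 1 + expr_cost e1 + expr_cost e2"

text \<open>All values occurring in the evaluation, addresses included, are less than \<open>W\<close>.\<close>

fun fits :: "nat \<Rightarrow> expr \<Rightarrow> state \<Rightarrow> bool" where
  "fits W (Const k) s \<longleftrightarrow> k < W"
| "fits W (Reg r) s \<longleftrightarrow> fst s r < W"
| "fits W (Load e) s \<longleftrightarrow> fits W e s \<and> expr_val (Load e) s < W"
| "fits W (Op f e1 e2) s \<longleftrightarrow> fits W e1 s \<and> fits W e2 s \<and> expr_val (Op f e1 e2) s < W"

text \<open>\<open>exec W P s t s'\<close>: started in \<open>s\<close>, the program \<open>P\<close> halts in \<open>s'\<close> after exactly \<open>t\<close> time units,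
  and no value reaches the word bound \<open>W\<close>.  A run in which some value reaches \<open>W\<close> has no result,
  so unit-cost arithmetic cannot be exploited on long numbers.\<close>

inductive exec :: "nat \<Rightarrow> com \<Rightarrow> state \<Rightarrow> nat \<Rightarrow> state \<Rightarrow> bool" for W where
  Skip: "exec W Skip s 1 s"
| Assign: "fits W e s \<Longrightarrow>
    exec W (Assign r e) s (1 + expr_cost e) ((fst s)(r := expr_val e s), snd s)"
| Store: "fits W a s \<Longrightarrow> fits W e s \<Longrightarrow>
    exec W (Store a e) s (1 + expr_cost a + expr_cost e)
      (fst s, (snd s)(expr_val a s := expr_val e s))"
| Seq: "exec W c1 s t1 s' \<Longrightarrow> exec W c2 s' t2 s'' \<Longrightarrow> exec W (Seq c1 c2) s (t1 + t2) s''"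
| CondTrue: "fits W b s \<Longrightarrow> expr_val b s \<noteq> 0 \<Longrightarrow> exec W c1 s t s' \<Longrightarrow>
    exec W (Cond b c1 c2) s (1 + expr_cost b + t) s'"
| CondFalse: "fits W b s \<Longrightarrow> expr_val b s = 0 \<Longrightarrow> exec W c2 s t s' \<Longrightarrow>
    exec W (Cond b c1 c2) s (1 + expr_cost b + t) s'"
| WhileFalse: "fits W b s \<Longrightarrow> expr_val b s = 0 \<Longrightarrow>
    exec W (While b c) s (1 + expr_cost b) s"
| WhileTrue: "fits W b s \<Longrightarrow> expr_val b s \<noteq> 0 \<Longrightarrow> exec W c s t1 s' \<Longrightarrow>
    exec W (While b c) s' t2 s'' \<Longrightarrow>
    exec W (While b c) s (1 + expr_cost b + t1 + t2) s''"

inductive_cases exec_SkipE: "exec W Skip s t s'"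
inductive_cases exec_AssignE: "exec W (Assign r e) s t s'"
inductive_cases exec_StoreE: "exec W (Store a e) s t s'"
inductive_cases exec_SeqE: "exec W (Seq c1 c2) s t s'"
inductive_cases exec_CondE: "exec W (Cond b c1 c2) s t s'"
inductive_cases exec_WhileE: "exec W (While b c) s t s'"

lemma exec_deterministic:
  "exec W P s t s' \<Longrightarrow> exec W P s u s'' \<Longrightarrow> u = t \<and> s'' = s'"
proof (induction arbitrary: u s'' rule: exec.induct)
  case Skip
  from Skip.prems show ?case by (rule exec_SkipE) simp
next
  case Assign
  from Assign.prems show ?case by (rule exec_AssignE) simp
next
  case Store
  from Store.prems show ?case by (rule exec_StoreE) simp
next
  case (Seq c1 s t1 s1 c2 t2 s2)
  from Seq.prems show ?case
  proof (rule exec_SeqE)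
    fix v1 r v2
    assume u: "u = v1 + v2" and 1: "exec W c1 s v1 r" and 2: "exec W c2 r v2 s''"
    have "v1 = t1" "r = s1" using Seq.IH(1)[OF 1] by simp_all
    then show ?thesis using u Seq.IH(2)[of v2 s''] 2 by simp
  qed
next
  case (CondTrue b s c1 t s1 c2)
  from CondTrue.prems show ?case
  proof (rule exec_CondE)
    fix v assume "u = Suc (expr_cost b + v)" "exec W c1 s v s''"
    then show ?thesis using CondTrue.IH[of v s''] by simp
  qed (use CondTrue.hyps in simp)
next
  case (CondFalse b s c2 t s1 c1)
  from CondFalse.prems show ?case
  proof (rule exec_CondE)
    fix v assume "u = Suc (expr_cost b + v)" "exec W c2 s v s''"
    then show ?thesis using CondFalse.IH[of v s''] by simp
  qed (use CondFalse.hyps in simp)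
next
  case (WhileFalse b s c)
  from WhileFalse.prems show ?case
    by (rule exec_WhileE) (use WhileFalse.hyps in simp_all)
next
  case (WhileTrue b s c t1 s1 t2 s2)
  from WhileTrue.prems show ?case
  proof (rule exec_WhileE)
    fix v1 r v2
    assume u: "u = Suc (expr_cost b + v1 + v2)"
      and 1: "exec W c s v1 r" and 2: "exec W (While b c) r v2 s''"
    have "v1 = t1" "r = s1" using WhileTrue.IH(1)[OF 1] by simp_all
    then show ?thesis using u WhileTrue.IH(2)[of v2 s''] 2 by simp
  qed (use WhileTrue.hyps in simp)
qed

text \<open>Register \<open>0\<close> holds \<open>n\<close>, memory cell \<open>i\<close> holds \<open>\<pi>\<^sub>i\<close> for \<open>i = 1, \<dots>, n\<close>, and everything else is \<open>0\<close>.
  The output is expected in register \<open>0\<close>.\<close>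

definition perm_input :: "nat \<Rightarrow> (nat \<Rightarrow> nat) \<Rightarrow> state" where
  "perm_input n \<pi> = ((\<lambda>_. 0)(0 := n), \<lambda>i. if i \<in> {1..n} then \<pi> i else 0)"

text \<open>The word bound \<open>(n + 2) ^ c\<close> amounts to words of \<open>O(log n)\<close> bits.\<close>

definition computes_within :: "com \<Rightarrow> (nat \<Rightarrow> (nat \<Rightarrow> nat) \<Rightarrow> nat) \<Rightarrow> (nat \<Rightarrow> nat) \<Rightarrow> bool" where
  "computes_within P f T \<longleftrightarrow> (\<exists>c. \<forall>n \<pi>. \<pi> permutes {1..n} \<longrightarrow>
     (\<exists>t s. exec ((n + 2) ^ c) P (perm_input n \<pi>) t s \<and> t \<le> T n \<and> fst s 0 = f n \<pi>))"

end

theory Submission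
  imports Defs
begin

text \<open>In a permutation graph the clique cover number of a set of vertices is its independence number.
  Draw the vertices as the points \<open>(pos v, v)\<close>.  A lattice point \<open>(i, j)\<close>, i.e. a scanline,
  splits the plane into quadrants, and its north-west and south-east quadrants form a bag whose clique
  cover number is the larger of the two independence numbers.  The bags along a monotone lattice path
  from \<open>(0, 0)\<close> to \<open>(n, n)\<close> form a path decomposition.  Conversely, every tree
  decomposition admits such a path all of whose bags are contained in bags of the decomposition:
  subtrees of a tree have the Helly property and their intersection graph has no induced
  four-cycle, and a place where the path cannot be continued would exhibit such a cycle.
  Hence the tree-clique width is the minimum over lattice paths of the maximum independence number,
  which is found by dynamic programming after tabulating the independence numbers of all quadrants.\<close>

section \<open>Subtrees of a tree\<close>

text \<open>The clique cover number of a scanline bag is a maximum and not a sum because every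
  north-west vertex is adjacent to every south-east vertex, so a clique of one quadrant merges with
  any clique of the other. The running time depends on the direction in which a row is tabulated.
  Passing from row \<open>i\<close> to row \<open>i + 1\<close> would add a vertex \<open>u\<close>
  in the last position to the north-west quadrant, and the vertices independent of it have values
  strictly between \<open>j\<close> and \<open>u\<close>, which is no quadrant. Each row is
  therefore recomputed from scratch, inserting positions in an order in which the vertices
  independent of the new one are bounded in value on one side only and are already counted in the
  table. An insertion changes at most linearly many entries, so a row takes quadratic time.\<close>

lemma rtrancl_imp_distinct_path:
  assumes "(a, b) \<in> R\<^sup>*"
  shows "\<exists>p. p \<noteq> [] \<and> distinct p \<and> hd p = a \<and> last p = b \<and> successively (\<lambda>x y. (x, y) \<in> R) p"
  using assms
proof (induction rule: rtrancl_induct)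
  case base
  show ?case by (rule exI[of _ "[a]"]) simp
next
  case (step y z)
  then obtain p where p: "p \<noteq> []" "distinct p" "hd p = a" "last p = y"
    "successively (\<lambda>x y. (x, y) \<in> R) p" by blast
  show ?case
  proof (cases "z \<in> set p")
    case True
    then obtain p1 p2 where "p = p1 @ z # p2" by (meson split_list)
    then have "distinct (p1 @ [z]) \<and> hd (p1 @ [z]) = a \<and> last (p1 @ [z]) = z \<and>
        successively (\<lambda>x y. (x, y) \<in> R) (p1 @ [z])"
      using p by (auto simp: successively_append_iff hd_append split: if_splits)
    then show ?thesis by blast
  next
    case False
    then show ?thesis using p step(2)
      by (intro exI[of _ "p @ [z]"]) (auto simp: successively_append_iff)
  qed
qed

text \<open>A simple path from \<open>b\<close> to \<open>a\<close> avoiding the edge has at least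
  three vertices, as two would mean the deleted edge itself; \<open>(a, b)\<close> closes it to a
  cycle.\<close>

lemma acyclic_edge_is_bridge:
  assumes "tree N F" and ab: "(a, b) \<in> F"
  shows "(b, a) \<notin> (F - {(a, b), (b, a)})\<^sup>*"
proof
  let ?R = "F - {(a, b), (b, a)}"
  assume "(b, a) \<in> ?R\<^sup>*"
  then obtain p where p: "p \<noteq> []" "distinct p" "hd p = b" "last p = a"
    "successively (\<lambda>x y. (x, y) \<in> ?R) p" using rtrancl_imp_distinct_path[of b a ?R] by auto
  have "a \<noteq> b" using assms by (auto simp: tree_def graph_def irrefl_def)
  then have "length p \<noteq> 1" using p by (auto simp: length_Suc_conv)
  moreover have "length p \<noteq> 2" using p by (auto simp: length_Suc_conv numeral_2_eq_2)
  moreover have "length p \<noteq> 0" using p by simp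
  ultimately have l: "3 \<le> length p" by linarith
  have "(p ! i, p ! (Suc i mod length p)) \<in> F" if i: "i < length p" for i
  proof (cases "Suc i = length p")
    case True
    then have "p ! i = a" "p ! (Suc i mod length p) = b"
      using p by (auto simp: last_conv_nth hd_conv_nth simp flip: True)
    then show ?thesis using assms by simp
  next
    case False
    then show ?thesis using p i by (auto simp: successively_conv_nth)
  qed
  then have "is_cycle F p" using l p by (simp add: is_cycle_def)
  then show False using assms by (auto simp: tree_def)
qed

definition graph_dist :: "('a \<times> 'a) set \<Rightarrow> 'a \<Rightarrow> 'a \<Rightarrow> nat" where
  "graph_dist F r t = (LEAST m. (r, t) \<in> F ^^ m)"

lemma graph_dist_path: "(r, t) \<in> F\<^sup>* \<Longrightarrow> (r, t) \<in> F ^^ graph_dist F r t"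
  unfolding graph_dist_def by (rule LeastI_ex) (simp add: rtrancl_power)

lemma graph_dist_le: "(r, t) \<in> F ^^ m \<Longrightarrow> graph_dist F r t \<le> m"
  unfolding graph_dist_def by (rule Least_le)

lemma graph_dist_parent:
  assumes "(r, t) \<in> F\<^sup>*" "t \<noteq> r"
  obtains p where "(r, p) \<in> F\<^sup>*" "(p, t) \<in> F" "graph_dist F r p < graph_dist F r t"
proof (cases "graph_dist F r t")
  case 0
  then show ?thesis using assms graph_dist_path[OF assms(1)] by simp
next
  case (Suc k)
  then obtain p where p: "(r, p) \<in> F ^^ k" "(p, t) \<in> F"
    using graph_dist_path[OF assms(1)] by auto
  then show ?thesis using that[of p] graph_dist_le[OF p(1)] Suc
    by (simp add: relpow_imp_rtrancl)
qed

text \<open>If a subtree meeting \<open>S\<close> reaches as far up as the top node \<open>t\<close> of \<open>S\<close> without containing it,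
  then the edge from \<open>t\<close> to its parent is not a bridge.\<close>

lemma subtree_contains_top:
  assumes T: "tree N F" and r: "r \<in> N" and S: "S \<subseteq> N" "connected_on F S"
    and S': "S' \<subseteq> N" "connected_on F S'" and x: "x \<in> S" "x \<in> S'"
    and t: "t \<in> S" "\<And>z. z \<in> S \<Longrightarrow> graph_dist F r t \<le> graph_dist F r z"
    and y: "y \<in> S'" "graph_dist F r y \<le> graph_dist F r t"
  shows "t \<in> S'"
proof (rule ccontr)
  assume nt: "t \<notin> S'"
  have sym: "sym F" using T by (simp add: tree_def graph_def)
  have reach: "(r, z) \<in> F\<^sup>*" if "z \<in> N" for z
    using T r that rtrancl_mono[of "F \<inter> N \<times> N" F] by (auto simp: tree_def connected_on_def)
  have "t \<noteq> r"
  proof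
    assume "t = r"
    then have "graph_dist F r t = 0" using graph_dist_le[of r r 0 F] by simp
    then have "y = r" using y graph_dist_path[OF reach[of y]] S' by auto
    then show False using \<open>t = r\<close> y nt by simp
  qed
  then obtain p where p: "(r, p) \<in> F\<^sup>*" "(p, t) \<in> F" "graph_dist F r p < graph_dist F r t"
    using graph_dist_parent[OF reach[of t]] t S by blast
  define F' where "F' = F - {(p, t), (t, p)}"
  have sym': "sym (F'\<^sup>*)" using sym by (intro sym_rtrancl) (auto simp: F'_def sym_def)
  \<comment> \<open>A shortest walk from the root to such a \<open>z\<close> stays strictly closer
    to the root than \<open>t\<close> before its end, so it avoids \<open>t\<close> and the deleted
    edge.\<close>
  have up: "(r, z) \<in> F'\<^sup>*"
    if "(r, z) \<in> F\<^sup>*" "graph_dist F r z \<le> graph_dist F r t" "z \<noteq> t" for z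
    using that
  proof (induction "graph_dist F r z" arbitrary: z rule: less_induct)
    case less
    show ?case
    proof (cases "z = r")
      case False
      then obtain q where q: "(r, q) \<in> F\<^sup>*" "(q, z) \<in> F" "graph_dist F r q < graph_dist F r z"
        using graph_dist_parent[OF less(2)] by blast
      then have "q \<noteq> t" using less by auto
      then have "(r, q) \<in> F'\<^sup>*" using less(1)[of q] q less.prems by simp
      moreover have "(q, z) \<in> F'" using q \<open>q \<noteq> t\<close> less by (auto simp: F'_def)
      ultimately show ?thesis by simp
    qed simp
  qed
  have rp: "(r, p) \<in> F'\<^sup>*" using p by (intro up) auto
  have ry: "(r, y) \<in> F'\<^sup>*" using y S' nt reach by (intro up) auto
  have "F \<inter> S' \<times> S' \<subseteq> F'" using nt by (auto simp: F'_def)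
  then have yx: "(y, x) \<in> F'\<^sup>*"
    using S' y x rtrancl_mono unfolding connected_on_def by blast
  have "p \<notin> S" using t(2)[of p] p by auto
  then have "F \<inter> S \<times> S \<subseteq> F'" by (auto simp: F'_def)
  then have xt: "(x, t) \<in> F'\<^sup>*"
    using S t x rtrancl_mono unfolding connected_on_def by blast
  \<comment> \<open>The detour around the bridge: from \<open>p\<close> up to \<open>r\<close>, down
    to \<open>y\<close>, through \<open>S'\<close> to \<open>x\<close> and through \<open>S\<close>
    to \<open>t\<close>.\<close>
  have "(p, t) \<in> F'\<^sup>*"
    using rp ry yx xt sym' by (meson rtrancl_trans symD)
  then have "(t, p) \<in> F'\<^sup>*" using sym' by (meson symD)
  then show False using acyclic_edge_is_bridge[OF T p(2)] by (simp add: F'_def)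
qed

lemma subtree_top:
  assumes "tree N F" "r \<in> N" "S \<noteq> {}"
  obtains t where "t \<in> S" "\<And>z. z \<in> S \<Longrightarrow> graph_dist F r t \<le> graph_dist F r z"
  using exists_least_iff[of "\<lambda>k. \<exists>t\<in>S. graph_dist F r t = k"] assms
  by (metis ex_in_conv not_less)

text \<open>The deepest of the tops lies in every member: each one meets the member with that top
  and has its own top no deeper, as \<open>subtree_contains_top\<close> requires.\<close>

lemma subtrees_Helly:
  assumes T: "tree N F" and fin: "finite \<S>" "\<S> \<noteq> {}"
    and S: "\<And>S. S \<in> \<S> \<Longrightarrow> S \<subseteq> N \<and> connected_on F S"
    and meet: "\<And>S S'. S \<in> \<S> \<Longrightarrow> S' \<in> \<S> \<Longrightarrow> S \<inter> S' \<noteq> {}"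
  shows "\<Inter>\<S> \<noteq> {}"
proof -
  obtain r where r: "r \<in> N" using T by (auto simp: tree_def)
  let ?d = "graph_dist F r"
  have "\<exists>t. t \<in> S \<and> (\<forall>z\<in>S. ?d t \<le> ?d z)" if "S \<in> \<S>" for S
    using subtree_top[OF T r, of S] meet[OF that that] by (metis Int_absorb)
  then obtain top where top: "\<And>S. S \<in> \<S> \<Longrightarrow> top S \<in> S \<and> (\<forall>z\<in>S. ?d (top S) \<le> ?d z)" by metis
  obtain S where deep: "S \<in> \<S>" "\<And>S'. S' \<in> \<S> \<Longrightarrow> ?d (top S') \<le> ?d (top S)"
    using Max_in[of "(\<lambda>S. ?d (top S)) ` \<S>"] Max_ge[of "(\<lambda>S. ?d (top S)) ` \<S>"] fin by fastforce
  have "top S \<in> S'" if S': "S' \<in> \<S>" for S'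
  proof -
    obtain x where "x \<in> S" "x \<in> S'" using meet[OF deep(1) S'] by auto
    then show ?thesis
      using subtree_contains_top[OF T r, of S S' x "top S" "top S'"] S S' deep top by blast
  qed
  then show ?thesis by auto
qed

text \<open>Around the cycle \<open>A\<close>, \<open>C\<close>, \<open>B\<close>, \<open>D\<close>
  some top is at least as deep as the tops of both its neighbours. Both neighbours then contain it,
  so they meet.\<close>

lemma subtrees_no_induced_C4:
  assumes T: "tree N F"
    and sub: "A \<subseteq> N" "B \<subseteq> N" "C \<subseteq> N" "D \<subseteq> N"
    and con: "connected_on F A" "connected_on F B" "connected_on F C" "connected_on F D"
    and meet: "A \<inter> C \<noteq> {}" "A \<inter> D \<noteq> {}" "B \<inter> C \<noteq> {}" "B \<inter> D \<noteq> {}"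
  shows "A \<inter> B \<noteq> {} \<or> C \<inter> D \<noteq> {}"
proof -
  obtain r where r: "r \<in> N" using T by (auto simp: tree_def)
  let ?d = "graph_dist F r"
  have shared: "P \<inter> Q \<noteq> {}"
    if "S \<subseteq> N" "P \<subseteq> N" "Q \<subseteq> N" "connected_on F S" "connected_on F P" "connected_on F Q"
      "S \<inter> P \<noteq> {}" "S \<inter> Q \<noteq> {}" and t: "t \<in> S" "\<forall>z\<in>S. ?d t \<le> ?d z"
      and "p \<in> P" "?d p \<le> ?d t" "q \<in> Q" "?d q \<le> ?d t" for S P Q t p q
    using subtree_contains_top[OF T r, of S P _ t p] subtree_contains_top[OF T r, of S Q _ t q] that
    by blast
  have top: "\<exists>t. t \<in> S \<and> (\<forall>z\<in>S. ?d t \<le> ?d z)" if "S \<noteq> {}" for S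
    using subtree_top[OF T r that] by metis
  obtain a where a: "a \<in> A" "\<forall>z\<in>A. ?d a \<le> ?d z" using top[of A] meet by auto
  obtain b where b: "b \<in> B" "\<forall>z\<in>B. ?d b \<le> ?d z" using top[of B] meet by auto
  obtain c where c: "c \<in> C" "\<forall>z\<in>C. ?d c \<le> ?d z" using top[of C] meet by auto
  obtain d where d: "d \<in> D" "\<forall>z\<in>D. ?d d \<le> ?d z" using top[of D] meet by auto
  consider "?d c \<le> ?d a" "?d d \<le> ?d a" | "?d c \<le> ?d b" "?d d \<le> ?d b"
    | "?d a \<le> ?d c" "?d b \<le> ?d c" | "?d a \<le> ?d d" "?d b \<le> ?d d" by linarith
  then show ?thesis
  proof cases
    case 1
    then show ?thesis using shared[of A C D a c d] sub con meet a c d by blast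
  next
    case 2
    then show ?thesis using shared[of B C D b c d] sub con meet b c d by blast
  next
    case 3
    then show ?thesis using shared[of C A B c a b] sub con meet a b c by blast
  next
    case 4
    then show ?thesis using shared[of D A B d a b] sub con meet a b d by blast
  qed
qed

section \<open>Independent sets and clique covers\<close>

definition independent_set :: "('a \<times> 'a) set \<Rightarrow> 'a set \<Rightarrow> bool" where
  "independent_set E I \<longleftrightarrow> (\<forall>u\<in>I. \<forall>v\<in>I. (u, v) \<notin> E)"

definition independence_number :: "('a \<times> 'a) set \<Rightarrow> 'a set \<Rightarrow> nat" where
  "independence_number E A = Max (card ` {I. I \<subseteq> A \<and> independent_set E I})"

lemma independent_set_subset: "independent_set E J \<Longrightarrow> I \<subseteq> J \<Longrightarrow> independent_set E I"
  by (auto simp: independent_set_def)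

lemma independence_number_ge:
  "finite A \<Longrightarrow> I \<subseteq> A \<Longrightarrow> independent_set E I \<Longrightarrow> card I \<le> independence_number E A"
  unfolding independence_number_def by (rule Max_ge) auto

lemma independence_number_attained:
  assumes "finite A"
  obtains I where "I \<subseteq> A" "independent_set E I" "card I = independence_number E A"
proof -
  have "independence_number E A \<in> card ` {I. I \<subseteq> A \<and> independent_set E I}"
    unfolding independence_number_def using assms
    by (intro Max_in) (auto simp: independent_set_def)
  then show thesis using that by auto
qed

lemma independence_number_mono:
  "finite B \<Longrightarrow> A \<subseteq> B \<Longrightarrow> independence_number E A \<le> independence_number E B"
  by (metis independence_number_attained independence_number_ge finite_subset subset_trans)

lemma independence_number_le_card: "finite A \<Longrightarrow> independence_number E A \<le> card A"
  by (metis independence_number_attained card_mono)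

lemma independence_number_empty [simp]: "independence_number E {} = 0"
  using independence_number_le_card[of "{}" E] by simp

text \<open>An optimal set either avoids \<open>u\<close> or consists of \<open>u\<close> and an
  independent set of non-neighbours. This recurrence lies behind the table updates.\<close>

lemma independence_number_insert:
  assumes A: "finite A" "u \<notin> A" and E: "sym E" "(u, u) \<notin> E"
  shows "independence_number E (insert u A) =
    max (independence_number E A) (1 + independence_number E {w \<in> A. (u, w) \<notin> E})"
    (is "?l = max ?a (1 + ?b)")
proof (rule antisym)
  obtain I where I: "I \<subseteq> insert u A" "independent_set E I" "card I = ?l"
    using independence_number_attained[of "insert u A" E] A by auto
  show "?l \<le> max ?a (1 + ?b)"
  proof (cases "u \<in> I")
    case True
    have "I - {u} \<subseteq> {w \<in> A. (u, w) \<notin> E}" using I True by (auto simp: independent_set_def)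
    then have "card (I - {u}) \<le> ?b"
      using A independent_set_subset[OF I(2)] by (intro independence_number_ge) auto
    moreover have "card I = 1 + card (I - {u})"
      using card_Suc_Diff1[of I u] finite_subset[OF I(1)] True A by simp
    ultimately show ?thesis using I by simp
  next
    case False
    then have "card I \<le> ?a" using I A by (intro independence_number_ge) auto
    then show ?thesis using I by simp
  qed
next
  obtain I where I: "I \<subseteq> {w \<in> A. (u, w) \<notin> E}" "independent_set E I" "card I = ?b"
    using independence_number_attained[of "{w \<in> A. (u, w) \<notin> E}" E] A by auto
  have "independent_set E (insert u I)"
    using I E by (auto simp: independent_set_def dest: symD)
  then have "card (insert u I) \<le> ?l"
    using A I by (intro independence_number_ge) auto
  moreover have "card (insert u I) = 1 + card I"
    using A I finite_subset[of I A] by (subst card_insert_disjoint) auto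
  ultimately show "max ?a (1 + ?b) \<le> ?l"
    using I A independence_number_mono[of "insert u A" A E] by auto
qed

text \<open>A clique holds at most one vertex of \<open>I\<close>, so choosing a clique around each
  vertex is injective.\<close>

lemma independent_set_card_le_clique_cover:
  assumes "finite C" "\<And>K. K \<in> C \<Longrightarrow> clique V E K" "I \<subseteq> \<Union>C" "independent_set E I"
  shows "card I \<le> card C"
proof -
  have "\<forall>v\<in>I. \<exists>K. K \<in> C \<and> v \<in> K" using assms(3) by blast
  then obtain f where f: "\<forall>v\<in>I. f v \<in> C \<and> v \<in> f v" unfolding bchoice_iff ..
  have "inj_on f I"
  proof (rule inj_onI, rule ccontr)
    fix u v assume uv: "u \<in> I" "v \<in> I" "f u = f v" "u \<noteq> v"
    have "clique V E (f u)" using f uv assms(2) by blast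
    moreover have "u \<in> f u" "v \<in> f u" using f uv by auto
    ultimately show False using uv assms(4) unfolding clique_def independent_set_def by blast
  qed
  moreover have "f ` I \<subseteq> C" using f by blast
  ultimately show ?thesis using assms(1) by (rule card_inj_on_le)
qed

section \<open>Bottleneck lattice paths\<close>

text \<open>The value \<open>0\<close> outside the quarter plane lets paths start anywhere on the two axes; this makes no
  difference for weights that increase along the axes.\<close>

function minimax :: "(nat \<Rightarrow> nat \<Rightarrow> nat) \<Rightarrow> nat \<Rightarrow> nat \<Rightarrow> nat" where
  "minimax w i j = max (w i j)
     (min (if i = 0 then 0 else minimax w (i - 1) j) (if j = 0 then 0 else minimax w i (j - 1)))"
  by auto
termination by (relation "measure (\<lambda>(w, i, j). i + j)") auto

declare minimax.simps [simp del]

definition lattice_step :: "nat \<times> nat \<Rightarrow> nat \<times> nat \<Rightarrow> bool" where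
  "lattice_step p q \<longleftrightarrow> q = (Suc (fst p), snd p) \<or> q = (fst p, Suc (snd p))"

lemma minimax_lattice_path:
  assumes mono: "\<And>i i'. i \<le> i' \<Longrightarrow> w i 0 \<le> w i' 0" "\<And>j j'. j \<le> j' \<Longrightarrow> w 0 j \<le> w 0 j'"
  shows "\<exists>f. f 0 = (0, 0) \<and> f (i + j) = (i, j) \<and> (\<forall>m<i + j. lattice_step (f m) (f (Suc m))) \<and>
    (\<forall>m\<le>i + j. case_prod w (f m) \<le> minimax w i j)"
proof (induction "i + j" arbitrary: i j rule: less_induct)
  case less
  note ub = minimax.simps[of w i j]
  have extend: ?case
    if prev: "i + j = Suc (i' + j')" "lattice_step (i', j') (i, j)" "minimax w i' j' \<le> minimax w i j"
      for i' j'
  proof -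
    obtain f where f: "f 0 = (0, 0)" "f (i' + j') = (i', j')"
        "\<forall>m<i' + j'. lattice_step (f m) (f (Suc m))"
        "\<forall>m\<le>i' + j'. case_prod w (f m) \<le> minimax w i' j'"
      using less[of i' j'] prev(1) by auto
    have "w i j \<le> minimax w i j" using ub by simp
    then show ?thesis using prev f
      by (intro exI[of _ "f(i + j := (i, j))"]) (auto simp: le_Suc_eq less_Suc_eq intro: order_trans)
  qed
  consider "i = 0" | "j = 0" | "i > 0" "j > 0" "minimax w (i - 1) j \<le> minimax w i (j - 1)"
    | "i > 0" "j > 0" "minimax w i (j - 1) \<le> minimax w (i - 1) j" by linarith
  then show ?case
  proof cases
    case 1
    \<comment> \<open>On an axis the path runs straight, and monotone weights attain their maximum
      at its end.\<close>
    then show ?thesis using mono ub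
      by (intro exI[of _ "\<lambda>m. (0, m)"]) (auto simp: lattice_step_def)
  next
    case 2
    then show ?thesis using mono ub
      by (intro exI[of _ "\<lambda>m. (m, 0)"]) (auto simp: lattice_step_def)
  next
    case 3
    then show ?thesis using ub by (intro extend[of "i - 1" j]) (auto simp: lattice_step_def)
  next
    case 4
    then show ?thesis using ub by (intro extend[of i "j - 1"]) (auto simp: lattice_step_def)
  qed
qed

section \<open>Scanlines of a permutation graph\<close>

lemma connected_on_path:
  fixes S :: "nat set"
  assumes S: "S \<subseteq> {..m}" "\<And>r s t. r \<in> S \<Longrightarrow> t \<in> S \<Longrightarrow> r \<le> s \<Longrightarrow> s \<le> t \<Longrightarrow> s \<in> S"
  shows "connected_on {(s, t). s \<le> m \<and> t \<le> m \<and> (t = Suc s \<or> s = Suc t)} S"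
proof -
  let ?R = "{(s, t). s \<le> m \<and> t \<le> m \<and> (t = Suc s \<or> s = Suc t)} \<inter> S \<times> S"
  have up: "(r, t) \<in> ?R\<^sup>*" if "r \<le> t" "r \<in> S" "t \<in> S" for r t
    using that
  proof (induction rule: dec_induct)
    case (step t)
    then have t: "t \<in> S" using S(2)[of r "Suc t" t] by simp
    then have "(r, t) \<in> ?R\<^sup>*" using step by blast
    moreover have "(t, Suc t) \<in> ?R" using t step S(1) by auto
    ultimately show ?case by (rule rtrancl_into_rtrancl)
  qed simp
  have "sym (?R\<^sup>*)" by (rule sym_rtrancl) (auto simp: sym_def)
  then show ?thesis unfolding connected_on_def using up by (meson linear symD)
qed

lemma tree_path: "tree {..m::nat} {(s, t). s \<le> m \<and> t \<le> m \<and> (t = Suc s \<or> s = Suc t)}"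
  (is "tree _ ?F")
proof -
  have False if "is_cycle ?F p" for p
  proof -
    have p: "3 \<le> length p" "distinct p" "\<And>i. i < length p \<Longrightarrow> (p ! i, p ! (Suc i mod length p)) \<in> ?F"
      using that by (auto simp: is_cycle_def)
    \<comment> \<open>Both cyclic neighbours of the largest entry must be that entry minus one, so
      they coincide, contradicting distinctness.\<close>
    have "Max (set p) \<in> set p" using p(1) by (intro Max_in) auto
    then obtain i where i: "i < length p" "p ! i = Max (set p)" by (auto simp: in_set_conv_nth)
    have le: "p ! k \<le> p ! i" if "k < length p" for k using i(2) that by simp
    define prv where "prv = (if i = 0 then length p - 1 else i - 1)"
    define nxt where "nxt = (if Suc i = length p then 0 else Suc i)"
    have bounds: "prv < length p" "nxt < length p" using p(1) i(1) by (auto simp: prv_def nxt_def)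
    have "Suc prv mod length p = i" "Suc i mod length p = nxt"
      using p(1) i(1) by (auto simp: prv_def nxt_def)
    then have "p ! i = Suc (p ! prv)" "p ! i = Suc (p ! nxt)"
      using p(3)[of prv] p(3)[of i] le[of prv] le[of nxt] bounds i(1) by auto
    then have "prv = nxt" using p(2) bounds nth_eq_iff_index_eq by fastforce
    then show False using p(1) i(1) by (auto simp: prv_def nxt_def split: if_splits)
  qed
  moreover have "connected_on ?F {..m}" by (rule connected_on_path) auto
  moreover have "graph {..m} ?F" by (auto simp: graph_def sym_def irrefl_def)
  ultimately show ?thesis unfolding tree_def by blast
qed

locale perm_graph =
  fixes n :: nat and \<pi> :: "nat \<Rightarrow> nat"
  assumes perm: "\<pi> permutes {1..n}"
begin

abbreviation "pos \<equiv> inv \<pi>"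
abbreviation "V \<equiv> {1..n}"
abbreviation "E \<equiv> perm_graph_edges n \<pi>"

text \<open>The lattice point \<open>(i, j)\<close> stands for the scanline separating the first \<open>i\<close> positions from
  the others on one line and the values up to \<open>j\<close> from the others on the other line; the vertices
  crossing it are those of the two quadrants.\<close>

definition NW :: "nat \<Rightarrow> nat \<Rightarrow> nat set" where
  "NW i j = {v \<in> V. pos v \<le> i \<and> j < v}"

definition SE :: "nat \<Rightarrow> nat \<Rightarrow> nat set" where
  "SE i j = {v \<in> V. i < pos v \<and> v \<le> j}"

definition cut_width :: "nat \<Rightarrow> nat \<Rightarrow> nat" where
  "cut_width i j = max (independence_number E (NW i j)) (independence_number E (SE i j))"

lemma edge_iff:
  "(u, v) \<in> E \<longleftrightarrow> u \<in> V \<and> v \<in> V \<and> (u < v \<and> pos v < pos u \<or> v < u \<and> pos u < pos v)"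
  by (auto simp: perm_graph_edges_def mult_less_0_iff)

lemma sym_E: "sym E" and irrefl_E: "(u, u) \<notin> E"
  by (auto simp: sym_def edge_iff)

lemma pos_in: "v \<in> V \<Longrightarrow> pos v \<in> V"
  using permutes_in_image[OF permutes_inv[OF perm]] by simp

lemma inj_pos: "pos u = pos v \<longleftrightarrow> u = v"
  using permutes_inj[OF permutes_inv[OF perm]] by (auto dest: injD)

lemma pos_perm [simp]: "pos (\<pi> p) = p"
  using permutes_inverses[OF perm] by simp

lemma perm_in: "p \<in> V \<Longrightarrow> \<pi> p \<in> V"
  using permutes_in_image[OF perm] by simp

lemma finite_quadrants [simp]: "finite (NW i j)" "finite (SE i j)"
  by (simp_all add: NW_def SE_def)

lemma quadrants_empty [simp]: "NW 0 j = {}" "SE i 0 = {}"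
  using pos_in by (force simp: NW_def SE_def)+

text \<open>Independent sets are increasing sequences of points, so the vertices of one level are pairwise
  incomparable in the dominance order and form a clique, as in Mirsky's theorem.\<close>

definition level :: "nat set \<Rightarrow> nat \<Rightarrow> nat" where
  "level X x = independence_number E {y \<in> X. y \<le> x \<and> pos y \<le> pos x}"

lemma level_bounds:
  assumes "finite X" "x \<in> X"
  shows "level X x \<in> {1..independence_number E X}"
proof -
  have "independent_set E {x}" using irrefl_E by (simp add: independent_set_def)
  then have "card {x} \<le> level X x"
    unfolding level_def using assms by (intro independence_number_ge) auto
  moreover have "level X x \<le> independence_number E X"
    unfolding level_def using assms by (intro independence_number_mono) auto
  ultimately show ?thesis by simp
qed

lemma level_strict_mono:
  assumes "finite X" "x \<in> X" "y < x" "pos y < pos x"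
  shows "level X y < level X x"
proof -
  let ?down = "\<lambda>x. {y \<in> X. y \<le> x \<and> pos y \<le> pos x}"
  obtain I where I: "I \<subseteq> ?down y" "independent_set E I" "card I = level X y"
    using independence_number_attained[of "?down y" E] assms(1) unfolding level_def by auto
  have "independent_set E (insert x I)"
    using I assms(3,4) by (fastforce simp: independent_set_def edge_iff)
  then have "card (insert x I) \<le> level X x"
    unfolding level_def using I assms by (intro independence_number_ge) auto
  moreover have "x \<notin> I" using I assms by auto
  moreover have "finite I" using finite_subset[OF I(1)] assms(1) by simp
  ultimately show ?thesis using I by simp
qed

lemma level_eq_imp_edge:
  assumes "finite X" "X \<subseteq> V" "x \<in> X" "y \<in> X" "x \<noteq> y" "level X x = level X y"
  shows "(x, y) \<in> E"
  using level_strict_mono[of X x y] level_strict_mono[of X y x] assms inj_pos[of x y]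
  by (auto simp: edge_iff subset_iff neq_iff)

lemma NW_SE_edge:
  assumes "u \<in> NW i j" "v \<in> SE i j"
  shows "(u, v) \<in> E" "(v, u) \<in> E"
  using assms
  by (auto simp: NW_def SE_def edge_iff)

text \<open>Level \<open>l\<close> of one quadrant and level \<open>l\<close> of the other unite to
  one clique by \<open>NW_SE_edge\<close>. Past the last level of a quadrant its half is
  empty.\<close>

lemma scanline_clique_cover:
  obtains C where "finite C" "\<And>K. K \<in> C \<Longrightarrow> clique V E K" "\<Union>C = NW i j \<union> SE i j"
    "card C \<le> cut_width i j"
proof
  let ?A = "NW i j" and ?B = "SE i j"
  let ?K = "\<lambda>l. {x \<in> ?A. level ?A x = l} \<union> {x \<in> ?B. level ?B x = l}"
  let ?C = "?K ` {1..cut_width i j}"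
  show "finite ?C" by simp
  show "card ?C \<le> cut_width i j" using card_image_le[of "{1..cut_width i j}" ?K] by simp
  have sub: "?A \<subseteq> V" "?B \<subseteq> V" by (auto simp: NW_def SE_def)
  have "clique V E (?K l)" for l
    unfolding clique_def
  proof (intro conjI ballI impI)
    show "?K l \<subseteq> V" using sub by blast
    fix u v assume u: "u \<in> ?K l" and v: "v \<in> ?K l" and "u \<noteq> v"
    consider "u \<in> ?A" "v \<in> ?A" "level ?A u = level ?A v" | "u \<in> ?B" "v \<in> ?B" "level ?B u = level ?B v"
      | "u \<in> ?A" "v \<in> ?B" | "v \<in> ?A" "u \<in> ?B" using u v by auto
    then show "(u, v) \<in> E"
      by cases (use level_eq_imp_edge[OF _ sub(1) _ _ \<open>u \<noteq> v\<close>] level_eq_imp_edge[OF _ sub(2) _ _ \<open>u \<noteq> v\<close>]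
          NW_SE_edge in auto)
  qed
  then show "\<And>K. K \<in> ?C \<Longrightarrow> clique V E K" by blast
  show "\<Union>?C = ?A \<union> ?B"
  proof
    show "\<Union>?C \<subseteq> ?A \<union> ?B" by auto
    have "level ?A x \<in> {1..cut_width i j}" if "x \<in> ?A" for x
      using level_bounds[of ?A x] that by (simp add: cut_width_def le_max_iff_disj)
    moreover have "level ?B x \<in> {1..cut_width i j}" if "x \<in> ?B" for x
      using level_bounds[of ?B x] that by (simp add: cut_width_def le_max_iff_disj)
    ultimately show "?A \<union> ?B \<subseteq> \<Union>?C" by blast
  qed
qed

text \<open>A good lattice point \<open>(i, j)\<close>, one all of whose crossing vertices share bags pairwise, has a
  good predecessor: otherwise both \<open>(i, j - 1)\<close> and \<open>(i - 1, j)\<close> are bad, and the witnesses for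
  this, two vertices of \<open>NW i (j - 1)\<close> and two of \<open>SE (i - 1) j\<close>, form a four-cycle of subtrees.\<close>

lemma minimax_le_width:
  assumes decomp: "augmented_tree_decomposition V E N F X C"
    and good: "\<forall>u \<in> NW i j \<union> SE i j. \<forall>v \<in> NW i j \<union> SE i j. \<exists>t\<in>N. u \<in> X t \<and> v \<in> X t"
  shows "minimax cut_width i j \<le> width N C"
  using good
proof (induction "i + j" arbitrary: i j rule: less_induct)
  case less
  define nodes where "nodes v = {t \<in> N. v \<in> X t}" for v
  define close where "close u v \<longleftrightarrow> nodes u \<inter> nodes v \<noteq> {}" for u v
  have close_iff: "close u v \<longleftrightarrow> (\<exists>t\<in>N. u \<in> X t \<and> v \<in> X t)" for u v
    by (auto simp: close_def nodes_def)
  have td: "tree_decomposition V E N F X" and T: "tree N F"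
    using decomp by (auto simp: augmented_tree_decomposition_def tree_decomposition_def)
  have sub: "nodes v \<subseteq> N" for v by (auto simp: nodes_def)
  have con: "connected_on F (nodes v)" if "v \<in> V" for v
    using td that by (auto simp: tree_decomposition_def nodes_def)
  have refl: "close v v" if "v \<in> V" for v
    using td that by (auto simp: tree_decomposition_def close_iff)
  have close_sym: "close u v \<longleftrightarrow> close v u" for u v by (auto simp: close_def)
  have edge: "close u v" if "(u, v) \<in> E" for u v
    using td that by (auto simp: tree_decomposition_def close_iff)
  let ?S = "\<lambda>i j. NW i j \<union> SE i j"
  have good: "close u v" if "u \<in> ?S i j" "v \<in> ?S i j" for u v
    using less.prems that close_iff by blast
  have SV: "?S i j \<subseteq> V" for i j by (auto simp: NW_def SE_def)
  have "N \<noteq> {}" "finite N" using T by (auto simp: tree_def graph_def)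
  have "\<exists>t\<in>N. ?S i j \<subseteq> X t"
  proof (cases "?S i j = {}")
    case True
    then show ?thesis using \<open>N \<noteq> {}\<close> by auto
  next
    case False
    have "\<Inter>(nodes ` ?S i j) \<noteq> {}"
    proof (rule subtrees_Helly[OF T])
      show "finite (nodes ` ?S i j)" by simp
      show "nodes ` ?S i j \<noteq> {}" using False by simp
      show "\<And>S. S \<in> nodes ` ?S i j \<Longrightarrow> S \<subseteq> N \<and> connected_on F S"
        using sub con SV by blast
      show "\<And>S S'. S \<in> nodes ` ?S i j \<Longrightarrow> S' \<in> nodes ` ?S i j \<Longrightarrow> S \<inter> S' \<noteq> {}"
        using good unfolding close_def by blast
    qed
    then obtain t where "\<forall>v\<in>?S i j. t \<in> nodes v" by blast
    then show ?thesis using False by (auto simp: nodes_def)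
  qed
  then obtain t where t: "t \<in> N" "?S i j \<subseteq> X t" by blast
  have "independence_number E A \<le> width N C" if "A \<subseteq> ?S i j" for A
  proof -
    have "finite A" using that by (rule finite_subset) simp
    then obtain I where I: "I \<subseteq> A" "independent_set E I" "card I = independence_number E A"
      using independence_number_attained by blast
    have "card I \<le> card (C t)"
      by (rule independent_set_card_le_clique_cover[where V = V and E = E])
        (use decomp t I that in \<open>auto simp: augmented_tree_decomposition_def\<close>)
    also have "\<dots> \<le> width N C" unfolding width_def using t \<open>finite N\<close> by simp
    finally show ?thesis using I by simp
  qed
  then have w: "cut_width i j \<le> width N C" by (simp add: cut_width_def)
  have "(if i = 0 then 0 else minimax cut_width (i - 1) j) \<le> width N C \<or>
        (if j = 0 then 0 else minimax cut_width i (j - 1)) \<le> width N C"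
  proof (rule ccontr)
    assume neg: "\<not> ?thesis"
    then have ij: "i > 0" "j > 0" by (auto split: if_splits)
    \<comment> \<open>By induction a predecessor whose value exceeds the width cannot be
      good.\<close>
    have "\<exists>u\<in>?S (i - 1) j. \<exists>v\<in>?S (i - 1) j. \<not> close u v"
      using less.hyps[of "i - 1" j] neg ij close_iff by fastforce
    then obtain u v where uv: "u \<in> ?S (i - 1) j" "v \<in> ?S (i - 1) j" "\<not> close u v" by blast
    have "\<exists>u\<in>?S i (j - 1). \<exists>v\<in>?S i (j - 1). \<not> close u v"
      using less.hyps[of i "j - 1"] neg ij close_iff by fastforce
    then obtain x y where xy: "x \<in> ?S i (j - 1)" "y \<in> ?S i (j - 1)" "\<not> close x y" by blast
    have one_side: "u \<in> NW i j \<and> v \<in> NW i j \<or> u \<in> SE i j \<and> v \<in> SE i j"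
      if "u \<in> ?S i j" "v \<in> ?S i j" "\<not> close u v" for u v i j
      using that NW_SE_edge edge close_sym by blast
    \<comment> \<open>A bad pair in a quadrant that shrinks on the way back would already be bad at
      \<open>(i, j)\<close>, so each bad pair lies in the quadrant that grows.\<close>
    have mono: "NW (i - 1) j \<subseteq> NW i j" "SE i (j - 1) \<subseteq> SE i j" by (auto simp: NW_def SE_def)
    have uv_SE: "u \<in> SE (i - 1) j" "v \<in> SE (i - 1) j"
      using one_side[OF uv] good uv mono by blast+
    have xy_NW: "x \<in> NW i (j - 1)" "y \<in> NW i (j - 1)"
      using one_side[OF xy] good xy mono by blast+
    \<comment> \<open>Here \<open>pos b \<le> i \<le> pos a\<close> and
      \<open>a \<le> j \<le> b\<close>, so distinct vertices are adjacent; \<open>a = b\<close>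
      occurs for a vertex at the point \<open>(i, j)\<close> itself.\<close>
    have cross: "close b a" if "a \<in> SE (i - 1) j" "b \<in> NW i (j - 1)" for a b
    proof (cases "a = b")
      case True
      then show ?thesis using that refl by (auto simp: SE_def)
    next
      case False
      then have "pos a \<noteq> pos b" using inj_pos by simp
      then have "(b, a) \<in> E" using that False ij by (auto simp: SE_def NW_def edge_iff)
      then show ?thesis by (rule edge)
    qed
    have "close x y \<or> close u v"
      unfolding close_def
      by (rule subtrees_no_induced_C4[OF T sub sub sub sub])
        (use uv_SE xy_NW cross con in \<open>auto simp: close_def NW_def SE_def\<close>)
    then show False using uv xy by blast
  qed
  then show ?case using w minimax.simps[of cut_width i j] by auto
qed

section \<open>From lattice paths to path decompositions\<close>

lemma bags_of_lattice_path:
  assumes path: "f 0 = (0, 0)" "f (n + n) = (n, n)" "\<forall>m<n + n. lattice_step (f m) (f (Suc m))"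
  shows "tree_decomposition V E {..n + n} {(s, t). s \<le> n + n \<and> t \<le> n + n \<and> (t = Suc s \<or> s = Suc t)}
    (\<lambda>m. NW (fst (f m)) (snd (f m)) \<union> SE (fst (f m)) (snd (f m)))"
    (is "tree_decomposition V E _ ?F ?X")
proof -
  define a b where "a m = fst (f m)" and "b m = snd (f m)" for m
  have ends: "a 0 = 0" "b 0 = 0" "a (n + n) = n" "b (n + n) = n"
    using path by (auto simp: a_def b_def)
  have unit: "a (Suc m) = Suc (a m) \<and> b (Suc m) = b m \<or> a (Suc m) = a m \<and> b (Suc m) = Suc (b m)"
    if "m < n + n" for m
    using path(3) that unfolding lattice_step_def a_def b_def by (metis fst_conv snd_conv)
  have mono: "a s \<le> a t \<and> b s \<le> b t" if "s \<le> t" "t \<le> n + n" for s t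
    using that
  proof (induction rule: dec_induct)
    case (step k)
    then show ?case using unit[of k] by auto
  qed simp
  define X where "X m = NW (fst (f m)) (snd (f m)) \<union> SE (fst (f m)) (snd (f m))" for m
  \<comment> \<open>A vertex is met once one of the inequalities holds and passed once both do. A
    step changes one coordinate only, so no vertex is met and passed in the same step.\<close>
  have mem: "v \<in> X t \<longleftrightarrow> v \<in> V \<and> (pos v \<le> a t) \<noteq> (v \<le> b t)" for v t
    by (auto simp: X_def NW_def SE_def a_def b_def)
  have first: "\<exists>m<k. \<not> P m \<and> P (Suc m)" if "\<not> P 0" "P k" for P and k :: nat
    using that by (induction k) (auto intro: less_SucI)
  show ?thesis
    unfolding tree_decomposition_def X_def[symmetric]
  proof (intro conjI ballI)
    show "tree {..n + n} ?F" by (rule tree_path)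
    show "X t \<subseteq> V" for t by (auto simp: mem)
    show "\<exists>t\<in>{..n + n}. v \<in> X t" if v: "v \<in> V" for v
    proof -
      obtain m where m: "m < n + n" "\<not> (pos v \<le> a m \<or> v \<le> b m)"
          "pos v \<le> a (Suc m) \<or> v \<le> b (Suc m)"
        using first[of "\<lambda>m. pos v \<le> a m \<or> v \<le> b m" "n + n"] ends v pos_in[OF v] by auto
      have "v \<in> X (Suc m)" using m unit[OF m(1)] v by (auto simp: mem)
      then show ?thesis using m(1) by (intro bexI[of _ "Suc m"]) auto
    qed
    show "case e of (u, v) \<Rightarrow> \<exists>t\<in>{..n + n}. u \<in> X t \<and> v \<in> X t" if "e \<in> E" for e
    proof -
      obtain u v where uv: "e = (u, v) \<or> e = (v, u)" "u \<in> V" "v \<in> V" "u < v" "pos v < pos u"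
        using \<open>e \<in> E\<close> by (cases e) (auto simp: edge_iff)
      \<comment> \<open>at the first time when both endpoints have been met, neither has been passed yet\<close>
      obtain m where m: "m < n + n"
          "\<not> ((pos u \<le> a m \<or> u \<le> b m) \<and> (pos v \<le> a m \<or> v \<le> b m))"
          "pos u \<le> a (Suc m) \<or> u \<le> b (Suc m)" "pos v \<le> a (Suc m) \<or> v \<le> b (Suc m)"
        using first[of "\<lambda>m. (pos u \<le> a m \<or> u \<le> b m) \<and> (pos v \<le> a m \<or> v \<le> b m)" "n + n"]
          ends uv pos_in[of u] pos_in[of v] by auto
      have "u \<in> X (Suc m) \<and> v \<in> X (Suc m)"
        using m unit[OF m(1)] uv unfolding mem by linarith
      then show ?thesis using m(1) uv(1) by (auto intro!: bexI[of _ "Suc m"])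
    qed
    show "connected_on ?F {t \<in> {..n + n}. v \<in> X t}" for v
    proof (rule connected_on_path)
      show "{t \<in> {..n + n}. v \<in> X t} \<subseteq> {..n + n}" by auto
      fix r s t assume "r \<in> {t \<in> {..n + n}. v \<in> X t}" "t \<in> {t \<in> {..n + n}. v \<in> X t}" "r \<le> s" "s \<le> t"
      then show "s \<in> {t \<in> {..n + n}. v \<in> X t}"
        using mono[of r s] mono[of s t] by (auto simp: mem)
    qed
  qed
qed

lemma tcl_eq_minimax: "tcl V E = minimax cut_width n n"
proof (rule antisym)
  have "cut_width i 0 \<le> cut_width i' 0" if "i \<le> i'" for i i'
    using independence_number_mono[of "NW i' 0" "NW i 0" E] that
    by (force simp: cut_width_def NW_def)
  moreover have "cut_width 0 j \<le> cut_width 0 j'" if "j \<le> j'" for j j'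
    using independence_number_mono[of "SE 0 j'" "SE 0 j" E] that
    by (force simp: cut_width_def SE_def)
  ultimately obtain f where f: "f 0 = (0, 0)" "f (n + n) = (n, n)"
      "\<forall>m<n + n. lattice_step (f m) (f (Suc m))"
      "\<forall>m\<le>n + n. case_prod cut_width (f m) \<le> minimax cut_width n n"
    using minimax_lattice_path[of cut_width n n] by blast
  let ?X = "\<lambda>m. NW (fst (f m)) (snd (f m)) \<union> SE (fst (f m)) (snd (f m))"
  have "\<forall>m. \<exists>C. finite C \<and> (\<forall>K\<in>C. clique V E K) \<and> \<Union>C = ?X m \<and> card C \<le> case_prod cut_width (f m)"
    by (metis scanline_clique_cover case_prod_beta)
  then obtain C where C: "\<And>m. finite (C m)" "\<And>m. \<forall>K\<in>C m. clique V E K" "\<And>m. \<Union>(C m) = ?X m"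
      "\<And>m. card (C m) \<le> case_prod cut_width (f m)"
    by metis
  let ?F = "{(s, t). s \<le> n + n \<and> t \<le> n + n \<and> (t = Suc s \<or> s = Suc t)}"
  have "augmented_tree_decomposition V E {..n + n} ?F ?X C"
    unfolding augmented_tree_decomposition_def
    using bags_of_lattice_path[OF f(1-3)] C by (intro conjI ballI) auto
  then have "tcl V E \<le> width {..n + n} C"
    unfolding tcl_def by (intro Least_le exI conjI) (assumption, rule refl)
  also have "\<dots> \<le> minimax cut_width n n"
    unfolding width_def using C(4) f(4) by (fastforce intro: order_trans)
  finally show "tcl V E \<le> minimax cut_width n n" .
next
  obtain N :: "nat set" and F X C
    where D: "augmented_tree_decomposition V E N F X C" "width N C = tcl V E"
    using tcl_attained[OF graph_perm_graph] .
  \<comment> \<open>Nothing crosses the scanline \<open>(n, n)\<close>, so it is vacuously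
    good.\<close>
  have "NW n n \<union> SE n n = {}" using pos_in by (force simp: NW_def SE_def)
  then show "minimax cut_width n n \<le> tcl V E" using minimax_le_width[OF D(1), of n n] D(2) by simp
qed

end

section \<open>Running times of word RAM programs\<close>

text \<open>A timed total-correctness triple for one start state; an upper bound on the time lets
  branches of unequal cost share one statement.\<close>

definition runs :: "nat \<Rightarrow> com \<Rightarrow> state \<Rightarrow> nat \<Rightarrow> (state \<Rightarrow> bool) \<Rightarrow> bool" where
  "runs W c s T Q \<longleftrightarrow> (\<exists>t s'. exec W c s t s' \<and> t \<le> T \<and> Q s')"

lemma runs_exec: "exec W c s t s' \<Longrightarrow> t \<le> T \<Longrightarrow> Q s' \<Longrightarrow> runs W c s T Q"
  unfolding runs_def by blast

lemma runs_weaken: "runs W c s T Q \<Longrightarrow> T \<le> T' \<Longrightarrow> (\<And>s. Q s \<Longrightarrow> Q' s) \<Longrightarrow> runs W c s T' Q'"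
  unfolding runs_def by (meson le_trans)

lemma runs_Seq:
  assumes "runs W c1 s T1 Q1" "\<And>s'. Q1 s' \<Longrightarrow> runs W c2 s' T2 Q"
  shows "runs W (Seq c1 c2) s (T1 + T2) Q"
proof -
  obtain t1 s1 where 1: "exec W c1 s t1 s1" "t1 \<le> T1" "Q1 s1"
    using assms(1) by (auto simp: runs_def)
  obtain t2 s2 where 2: "exec W c2 s1 t2 s2" "t2 \<le> T2" "Q s2"
    using assms(2)[OF 1(3)] by (auto simp: runs_def)
  show ?thesis by (rule runs_exec[OF exec.Seq[OF 1(1) 2(1)]]) (use 1 2 in auto)
qed

text \<open>Loop-free programs are executed symbolically: final state, word bounds and time become
  functions that \<open>simp\<close> evaluates. The values at \<open>While\<close> are dummies,
  excluded by \<open>safe\<close>.\<close>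

fun effect :: "com \<Rightarrow> state \<Rightarrow> state" where
  "effect Skip s = s"
| "effect (Assign r e) s = ((fst s)(r := expr_val e s), snd s)"
| "effect (Store a e) s = (fst s, (snd s)(expr_val a s := expr_val e s))"
| "effect (Seq c1 c2) s = effect c2 (effect c1 s)"
| "effect (Cond b c1 c2) s = (if expr_val b s \<noteq> 0 then effect c1 s else effect c2 s)"
| "effect (While b c) s = s"

fun safe :: "nat \<Rightarrow> com \<Rightarrow> state \<Rightarrow> bool" where
  "safe W Skip s \<longleftrightarrow> True"
| "safe W (Assign r e) s \<longleftrightarrow> fits W e s"
| "safe W (Store a e) s \<longleftrightarrow> fits W a s \<and> fits W e s"
| "safe W (Seq c1 c2) s \<longleftrightarrow> safe W c1 s \<and> safe W c2 (effect c1 s)"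
| "safe W (Cond b c1 c2) s \<longleftrightarrow>
     fits W b s \<and> (if expr_val b s \<noteq> 0 then safe W c1 s else safe W c2 s)"
| "safe W (While b c) s \<longleftrightarrow> False"

fun cost :: "com \<Rightarrow> nat" where
  "cost Skip = 1"
| "cost (Assign r e) = 1 + expr_cost e"
| "cost (Store a e) = 1 + expr_cost a + expr_cost e"
| "cost (Seq c1 c2) = cost c1 + cost c2"
| "cost (Cond b c1 c2) = 1 + expr_cost b + max (cost c1) (cost c2)"
| "cost (While b c) = 0"

lemma exec_effect: "safe W c s \<Longrightarrow> \<exists>t\<le>cost c. exec W c s t (effect c s)"
proof (induction c arbitrary: s)
  case Skip
  show ?case using exec.Skip[of W s] by (intro exI[of _ 1]) simp
next
  case (Assign r e)
  then show ?case using exec.Assign[of W e s r] by (intro exI[of _ "1 + expr_cost e"]) simp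
next
  case (Store a e)
  then show ?case using exec.Store[of W a s e]
    by (intro exI[of _ "1 + expr_cost a + expr_cost e"]) simp
next
  case (Seq c1 c2)
  obtain t1 where 1: "t1 \<le> cost c1" "exec W c1 s t1 (effect c1 s)"
    using Seq.IH(1)[of s] Seq.prems by auto
  obtain t2 where 2: "t2 \<le> cost c2" "exec W c2 (effect c1 s) t2 (effect c2 (effect c1 s))"
    using Seq.IH(2)[of "effect c1 s"] Seq.prems by auto
  show ?case using exec.Seq[OF 1(2) 2(2)] 1(1) 2(1) by (intro exI[of _ "t1 + t2"]) simp
next
  case (Cond b c1 c2)
  show ?case
  proof (cases "expr_val b s = 0")
    case True
    then obtain t where t: "t \<le> cost c2" "exec W c2 s t (effect c2 s)"
      using Cond.IH(2)[of s] Cond.prems by auto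
    show ?thesis using exec.CondFalse[OF _ True t(2), of c1] Cond.prems True t(1)
      by (intro exI[of _ "1 + expr_cost b + t"]) simp
  next
    case False
    then obtain t where t: "t \<le> cost c1" "exec W c1 s t (effect c1 s)"
      using Cond.IH(1)[of s] Cond.prems by auto
    show ?thesis using exec.CondTrue[OF _ False t(2), of c2] Cond.prems False t(1)
      by (intro exI[of _ "1 + expr_cost b + t"]) simp
  qed
next
  case (While b c)
  then show ?case by simp
qed

lemma runs_effect: "safe W c s \<Longrightarrow> Q (effect c s) \<Longrightarrow> cost c \<le> T \<Longrightarrow> runs W c s T Q"
  using exec_effect[of W c s] runs_exec le_trans by blast

lemma runs_Seq_effect:
  "safe W c1 s \<Longrightarrow> runs W c2 (effect c1 s) T Q \<Longrightarrow> runs W (Seq c1 c2) s (cost c1 + T) Q"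
  by (rule runs_Seq[OF runs_effect[where Q = "\<lambda>s'. s' = effect c1 s"]]) auto

text \<open>The guard is evaluated \<open>K + 1\<close> times; charging a full round for the last
  evaluation keeps the bound a product.\<close>

lemma runs_While:
  assumes step: "\<And>k s. k < K \<Longrightarrow> Inv k s \<Longrightarrow>
      fits W b s \<and> expr_val b s \<noteq> 0 \<and> runs W c s T (Inv (Suc k))"
    and exit: "\<And>s. Inv K s \<Longrightarrow> fits W b s \<and> expr_val b s = 0"
    and init: "Inv 0 s"
  shows "runs W (While b c) s (Suc K * (1 + expr_cost b + T)) (Inv K)"
proof -
  have "runs W (While b c) s (Suc d * (1 + expr_cost b + T)) (Inv K)"
    if "d \<le> K" "Inv (K - d) s" for d s
    using that
  proof (induction d arbitrary: s)
    case 0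
    then have "fits W b s" "expr_val b s = 0" using exit[of s] by auto
    then show ?case by (rule runs_exec[OF exec.WhileFalse]) (use 0 in auto)
  next
    case (Suc d)
    have "K - Suc d < K" "Suc (K - Suc d) = K - d" using Suc by auto
    then have b: "fits W b s" "expr_val b s \<noteq> 0" and "runs W c s T (Inv (K - d))"
      using step[OF _ Suc.prems(2)] by auto
    then obtain t1 s1 where 1: "exec W c s t1 s1" "t1 \<le> T" "Inv (K - d) s1"
      by (auto simp: runs_def)
    then obtain t2 s2 where 2: "exec W (While b c) s1 t2 s2"
        "t2 \<le> Suc d * (1 + expr_cost b + T)" "Inv K s2"
      using Suc.IH[of s1] Suc.prems by (auto simp: runs_def)
    have "exec W (While b c) s (1 + expr_cost b + t1 + t2) s2"
      using b 1 2 by (blast intro: exec.WhileTrue)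
    moreover have "1 + expr_cost b + t1 + t2 \<le> Suc (Suc d) * (1 + expr_cost b + T)"
      using 1 2 by simp
    ultimately show ?case unfolding runs_def using 2 by blast
  qed
  from this[of K s] show ?thesis using init by simp
qed

section \<open>The algorithm\<close>

abbreviation "Add' a b \<equiv> Op Add a b"
abbreviation "Sub' a b \<equiv> Op Sub a b"
abbreviation "Less' a b \<equiv> Op Less a b"

text \<open>The memory is divided into segments of length \<open>n + 1\<close>, the first of which contains the input.
  The row \<open>i\<close> of the dynamic program reads the row \<open>i - 1\<close> in the segment \<open>3 * i + 1\<close>
  and fills the next three segments with the independence numbers of the north-west quadrants, those
  of the south-east quadrants, and its results.  Fresh segments need no initialization, and the segment
  read by row \<open>0\<close> consists of the zeros required by \<open>minimax\<close>.

  Registers: 0 holds \<open>n\<close>, 1 the row \<open>i\<close>, 2 the address of the segment \<open>3 * i + 1\<close>,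
  4 the segment length, 7 the last entry computed in the current row, 3 and 6 are loop counters, and
  5, 8, 9 are temporary.\<close>

definition raise_body :: com where
  "raise_body = Seq
     (Cond (Less' (Load (Add' (Reg 9) (Reg 6))) (Reg 5)) (Store (Add' (Reg 9) (Reg 6)) (Reg 5)) Skip)
     (Assign 6 (Add' (Reg 6) (Const 1)))"

text \<open>Register 9 is the base of the table, 6 and 8 delimit the half-open range of entries, and
  5 is the candidate to which they are raised.\<close>

definition raise_range :: com where
  "raise_range = While (Less' (Reg 6) (Reg 8)) raise_body"

definition NW_init :: com where
  "NW_init = Seq (Assign 3 (Reg 1)) (Assign 9 (Add' (Reg 2) (Reg 4)))"

text \<open>The candidate is one more than the entry at the new vertex; the raised range ends just
  before that entry.\<close>

definition NW_fetch :: com where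
  "NW_fetch = Seq (Assign 8 (Load (Reg 3)))
     (Seq (Assign 5 (Add' (Load (Add' (Reg 9) (Reg 8))) (Const 1))) (Assign 6 (Const 0)))"

definition NW_row :: com where
  "NW_row = Seq NW_init (While (Less' (Const 0) (Reg 3))
     (Seq NW_fetch (Seq raise_range (Assign 3 (Sub' (Reg 3) (Const 1))))))"

definition SE_init :: com where
  "SE_init = Seq (Assign 3 (Add' (Reg 1) (Const 1)))
     (Seq (Assign 9 (Add' (Reg 2) (Add' (Reg 4) (Reg 4)))) (Assign 8 (Reg 4)))"

text \<open>The entry read is the one just below the new vertex, where the raised range starts; its
  end \<open>n + 1\<close> stays in register 8 from \<open>SE_init\<close>.\<close>

definition SE_fetch :: com where
  "SE_fetch = Seq (Assign 6 (Load (Reg 3)))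
     (Assign 5 (Add' (Load (Sub' (Add' (Reg 9) (Reg 6)) (Const 1))) (Const 1)))"

definition SE_row :: com where
  "SE_row = Seq SE_init (While (Less' (Reg 3) (Reg 4))
     (Seq SE_fetch (Seq raise_range (Assign 3 (Add' (Reg 3) (Const 1))))))"

definition minimax_init :: com where
  "minimax_init = Seq (Assign 7 (Const 0)) (Seq (Assign 3 (Const 0))
     (Seq (Assign 5 (Add' (Reg 2) (Reg 4)))
     (Seq (Assign 6 (Add' (Reg 5) (Reg 4))) (Assign 8 (Add' (Reg 6) (Reg 4))))))"

text \<open>Register 7 enters with the left neighbour. The first conditional takes the minimum with
  the previous row, the other two take maxima with the quadrant tables.\<close>

definition minimax_body :: com where
  "minimax_body =
     Seq (Cond (Less' (Load (Add' (Reg 2) (Reg 3))) (Reg 7)) (Assign 7 (Load (Add' (Reg 2) (Reg 3)))) Skip)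
    (Seq (Cond (Less' (Reg 7) (Load (Add' (Reg 5) (Reg 3)))) (Assign 7 (Load (Add' (Reg 5) (Reg 3)))) Skip)
    (Seq (Cond (Less' (Reg 7) (Load (Add' (Reg 6) (Reg 3)))) (Assign 7 (Load (Add' (Reg 6) (Reg 3)))) Skip)
    (Seq (Store (Add' (Reg 8) (Reg 3)) (Reg 7))
         (Assign 3 (Add' (Reg 3) (Const 1))))))"

definition minimax_row :: com where
  "minimax_row = Seq minimax_init (While (Less' (Reg 3) (Reg 4)) minimax_body)"

text \<open>The result segment of a row doubles as the previous-row segment of the next.\<close>

definition next_row :: com where
  "next_row = Seq (Assign 2 (Reg 8)) (Assign 1 (Add' (Reg 1) (Const 1)))"

definition tcl_program :: com where
  "tcl_program = Seq (Seq (Assign 4 (Add' (Reg 0) (Const 1))) (Assign 2 (Reg 4)))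
     (Seq (While (Less' (Reg 1) (Reg 4)) (Seq NW_row (Seq SE_row (Seq minimax_row next_row))))
     (Assign 0 (Reg 7)))"

lemma raise_range_runs:
  assumes "r 6 \<le> r 8" "r 9 + r 8 < W" "r 5 < W" "1 < W"
    and "\<And>x. r 9 + r 6 \<le> x \<Longrightarrow> x < r 9 + r 8 \<Longrightarrow> m x < W"
  shows "runs W raise_range (r, m) (20 * (r 8 + 1)) (\<lambda>s'. s' = (r(6 := r 8),
    \<lambda>x. if r 9 + r 6 \<le> x \<and> x < r 9 + r 8 then max (m x) (r 5) else m x))"
proof -
  define K where "K = r 8 - r 6"
  define raised where
    "raised k = (\<lambda>x. if r 9 + r 6 \<le> x \<and> x < r 9 + (r 6 + k) then max (m x) (r 5) else m x)" for k
  define Inv where "Inv k s \<longleftrightarrow> s = (r(6 := r 6 + k), raised k)" for k s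
  \<comment> \<open>\<open>raise_body\<close> costs 16; with the guard and its branch a round costs
    20.\<close>
  have "runs W raise_range (r, m) (Suc K * (1 + expr_cost (Less' (Reg 6) (Reg 8)) + 16)) (Inv K)"
    unfolding raise_range_def
  proof (rule runs_While)
    show "Inv 0 (r, m)" by (auto simp: Inv_def raised_def)
    show "fits W (Less' (Reg 6) (Reg 8)) s \<and> expr_val (Less' (Reg 6) (Reg 8)) s = 0" if "Inv K s" for s
      using that assms by (auto simp: Inv_def K_def)
    fix k s assume k: "k < K" and "Inv k s"
    then have s: "s = (r(6 := r 6 + k), raised k)" by (simp add: Inv_def)
    have bounds: "r 9 + (r 6 + k) < W" "r 6 + k < r 8" "r 8 < W" using assms k by (auto simp: K_def)
    have old: "raised k (r 9 + (r 6 + k)) = m (r 9 + (r 6 + k))" by (simp add: raised_def)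
    have new: "raised (Suc k) =
        (raised k)(r 9 + (r 6 + k) := max (raised k (r 9 + (r 6 + k))) (r 5))"
      by (auto simp: raised_def fun_eq_iff)
    have mW: "m (r 9 + (r 6 + k)) < W" using assms bounds by simp
    have "runs W raise_body s 16 (Inv (Suc k))"
      by (rule runs_effect)
        (use bounds old mW assms(3,4) in
          \<open>auto simp: s raise_body_def Inv_def new max_def simp flip: old\<close>)
    then show "fits W (Less' (Reg 6) (Reg 8)) s \<and> expr_val (Less' (Reg 6) (Reg 8)) s \<noteq> 0 \<and>
        runs W raise_body s 16 (Inv (Suc k))"
      using bounds assms(2,4) by (auto simp: s)
  qed
  then show ?thesis
    by (rule runs_weaken) (use assms(1) in \<open>auto simp: Inv_def raised_def K_def fun_eq_iff\<close>)
qed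

lemma raise_range_runs_to:
  assumes "r 5 = t" "r 6 = lo" "r 8 = hi" "r 9 = C" "lo \<le> hi" "C + hi < W" "t < W" "1 < W"
    and "\<And>x. C + lo \<le> x \<Longrightarrow> x < C + hi \<Longrightarrow> m x < W"
    and "(\<lambda>x. if C + lo \<le> x \<and> x < C + hi then max (m x) t else m x) = m'"
  shows "runs W raise_range (r, m) (20 * (hi + 1)) (\<lambda>s'. s' = (r(6 := hi), m'))"
  using raise_range_runs[of r W m] assms by metis

section \<open>Correctness and running time\<close>

lemma minimax_le: "(\<And>i j. w i j \<le> c) \<Longrightarrow> minimax w i j \<le> c"
proof (induction "i + j" arbitrary: i j rule: less_induct)
  case less
  have "w i j \<le> c" by (rule less.prems)
  moreover have "i = 0 \<or> minimax w (i - 1) j \<le> c" using less by (cases "i = 0") auto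
  ultimately show ?case by (subst minimax.simps) auto
qed

context perm_graph
begin

text \<open>The tables after some of the positions have been processed, from \<open>i\<close> downwards
  for \<open>NW_part\<close> and from \<open>i + 1\<close> upwards for \<open>SE_part\<close>.  A new vertex \<open>u\<close> has extreme
  position, so the vertices independent of it are those on one side of \<open>u\<close>; the entry counting them is not
  affected by \<open>u\<close>, which allows updating the tables in place.\<close>

definition NW_part :: "nat \<Rightarrow> nat \<Rightarrow> nat \<Rightarrow> nat" where
  "NW_part i p a = independence_number E {v \<in> V. p < pos v \<and> pos v \<le> i \<and> a < v}"

definition SE_part :: "nat \<Rightarrow> nat \<Rightarrow> nat \<Rightarrow> nat" where
  "SE_part i p b = independence_number E {v \<in> V. i < pos v \<and> pos v \<le> p \<and> v \<le> b}"

lemma part_le: "NW_part i p a \<le> n" "SE_part i p b \<le> n"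
proof -
  have bound: "independence_number E A \<le> n" if "A \<subseteq> V" for A
    using independence_number_mono[OF _ that, of E] independence_number_le_card[of V E] by simp
  show "NW_part i p a \<le> n" unfolding NW_part_def by (rule bound) auto
  show "SE_part i p b \<le> n" unfolding SE_part_def by (rule bound) auto
qed

lemma NW_part_init: "NW_part i i a = 0"
proof -
  have "{v \<in> V. i < pos v \<and> pos v \<le> i \<and> a < v} = {}" by auto
  then show ?thesis by (simp only: NW_part_def independence_number_empty)
qed

lemma SE_part_init: "SE_part i i b = 0"
proof -
  have "{v \<in> V. i < pos v \<and> pos v \<le> i \<and> v \<le> b} = {}" by auto
  then show ?thesis by (simp only: SE_part_def independence_number_empty)
qed

section \<open>Recurrences for the quadrant tables\<close>

lemma NW_part_step:
  assumes "p < i" "i \<le> n"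
  shows "NW_part i p a = (if a < \<pi> (Suc p) then
    max (NW_part i (Suc p) a) (NW_part i (Suc p) (\<pi> (Suc p)) + 1) else NW_part i (Suc p) a)"
proof -
  let ?A = "\<lambda>p a. {v \<in> V. p < pos v \<and> pos v \<le> i \<and> a < v}"
  define u where "u = \<pi> (Suc p)"
  have u: "u \<in> V" "pos u = Suc p" using perm_in[of "Suc p"] assms by (auto simp: u_def)
  have split: "p < pos v \<longleftrightarrow> v = u \<or> Suc p < pos v" for v
    using inj_pos[of v u] u(2) by auto
  \<comment> \<open>As \<open>u\<close> precedes the others in position, it is independent exactly
    of the larger values.\<close>
  have nonneighbour: "(u, w) \<notin> E \<longleftrightarrow> u < w" if "w \<in> V" "Suc p < pos w" for w
    using that u by (cases u w rule: linorder_cases) (auto simp: edge_iff)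
  show ?thesis
  proof (cases "a < u")
    case True
    have "?A p a = insert u (?A (Suc p) a)"
      unfolding split using True assms(1) u by auto
    moreover have "{w \<in> ?A (Suc p) a. (u, w) \<notin> E} = ?A (Suc p) u"
      using nonneighbour True by auto
    moreover have "u \<notin> ?A (Suc p) a" "finite (?A (Suc p) a)" using u by auto
    ultimately show ?thesis
      using True independence_number_insert[OF _ _ sym_E irrefl_E, of "?A (Suc p) a" u]
      unfolding NW_part_def u_def[symmetric] by simp
  next
    case False
    then have "?A p a = ?A (Suc p) a" unfolding split by auto
    then show ?thesis using False unfolding NW_part_def u_def[symmetric] by simp
  qed
qed

lemma SE_part_step:
  assumes "i \<le> p" "p < n"
  shows "SE_part i (Suc p) b = (if \<pi> (Suc p) \<le> b then
    max (SE_part i p b) (SE_part i p (\<pi> (Suc p) - 1) + 1) else SE_part i p b)"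
proof -
  let ?A = "\<lambda>p b. {v \<in> V. i < pos v \<and> pos v \<le> p \<and> v \<le> b}"
  define u where "u = \<pi> (Suc p)"
  have u: "u \<in> V" "pos u = Suc p" using perm_in[of "Suc p"] assms by (auto simp: u_def)
  have split: "pos v \<le> Suc p \<longleftrightarrow> v = u \<or> pos v \<le> p" for v
    using inj_pos[of v u] u(2) by auto
  have nonneighbour: "(u, w) \<notin> E \<longleftrightarrow> w \<le> u - 1" if "w \<in> V" "pos w \<le> p" for w
    using that u by (cases u w rule: linorder_cases) (auto simp: edge_iff)
  show ?thesis
  proof (cases "u \<le> b")
    case True
    have "?A (Suc p) b = insert u (?A p b)"
      unfolding split using True assms(1) u by auto
    moreover have "{w \<in> ?A p b. (u, w) \<notin> E} = ?A p (u - 1)"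
      using nonneighbour True by auto
    moreover have "u \<notin> ?A p b" "finite (?A p b)" using u by auto
    ultimately show ?thesis
      using True independence_number_insert[OF _ _ sym_E irrefl_E, of "?A p b" u]
      unfolding SE_part_def u_def[symmetric] by simp
  next
    case False
    then have "?A (Suc p) b = ?A p b" unfolding split by auto
    then show ?thesis using False unfolding SE_part_def u_def[symmetric] by simp
  qed
qed

lemma cut_width_eq: "cut_width i j = max (NW_part i 0 j) (SE_part i n j)"
proof -
  have "NW i j = {v \<in> V. 0 < pos v \<and> pos v \<le> i \<and> j < v}"
    using pos_in by (force simp: NW_def)
  moreover have "SE i j = {v \<in> V. i < pos v \<and> pos v \<le> n \<and> v \<le> j}"
    using pos_in by (force simp: SE_def)
  ultimately show ?thesis by (simp only: cut_width_def NW_part_def SE_part_def)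
qed

lemma minimax_cut_width_le: "minimax cut_width i j \<le> n"
  by (rule minimax_le) (simp add: cut_width_eq part_le)

definition loop_state :: "nat \<Rightarrow> nat \<Rightarrow> state \<Rightarrow> bool" where
  "loop_state i B s \<longleftrightarrow> fst s 0 = n \<and> fst s 1 = i \<and> fst s 2 = B \<and> fst s 4 = Suc n"

text \<open>The raised addresses are exactly the entries \<open>a < \<pi> (Suc p)\<close>, the case
  in which \<open>NW_part_step\<close> takes a maximum.\<close>

lemma raised_NW_part:
  assumes "p < i" "i \<le> n"
    and m: "m = (\<lambda>x. if C \<le> x \<and> x < C + Suc n then NW_part i (Suc p) (x - C) else m0 x)"
  shows "(\<lambda>x. if C + 0 \<le> x \<and> x < C + \<pi> (Suc p)
      then max (m x) (NW_part i (Suc p) (\<pi> (Suc p)) + 1) else m x) =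
    (\<lambda>x. if C \<le> x \<and> x < C + Suc n then NW_part i p (x - C) else m0 x)" (is "?l = ?r")
proof
  fix x
  have "\<pi> (Suc p) \<le> n" using perm_in[of "Suc p"] assms(1,2) by simp
  moreover have "x - C < \<pi> (Suc p) \<longleftrightarrow> x < C + \<pi> (Suc p)" if "C \<le> x" using that by linarith
  ultimately show "?l x = ?r x"
    using NW_part_step[OF assms(1,2), of "x - C"] by (auto simp: m)
qed

lemma raised_SE_part:
  assumes "i \<le> p" "p < n"
    and m: "m = (\<lambda>x. if C \<le> x \<and> x < C + Suc n then SE_part i p (x - C) else m0 x)"
  shows "(\<lambda>x. if C + \<pi> (Suc p) \<le> x \<and> x < C + Suc n
      then max (m x) (SE_part i p (\<pi> (Suc p) - 1) + 1) else m x) =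
    (\<lambda>x. if C \<le> x \<and> x < C + Suc n then SE_part i (Suc p) (x - C) else m0 x)" (is "?l = ?r")
proof
  fix x
  have "\<pi> (Suc p) \<le> x - C \<longleftrightarrow> C + \<pi> (Suc p) \<le> x" if "C \<le> x" using that by linarith
  then show "?l x = ?r x"
    using SE_part_step[OF assms(1,2), of "x - C"] by (auto simp: m)
qed

text \<open>Common shape of the three row programs: start-up cost \<open>b\<close> and
  \<open>K\<close> rounds of cost at most linear in \<open>n\<close>.\<close>

lemma row_time:
  assumes "K \<le> Suc n" "a \<le> 40 * n + 100" "b \<le> 100"
  shows "b + Suc K * a \<le> 200 * ((n + 2) * (n + 2))"
proof -
  have "Suc K * a \<le> (n + 2) * (100 * (n + 2))" using assms by (intro mult_mono) auto
  moreover have "b \<le> 100 * ((n + 2) * (n + 2))" using assms by (simp add: algebra_simps)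
  ultimately show ?thesis by (simp add: algebra_simps)
qed

section \<open>Execution of a single row\<close>

lemma NW_row_runs:
  assumes s: "loop_state i B s" and i: "i \<le> n" and B: "Suc n \<le> B" "B + 4 * Suc n < W"
    and mem: "\<And>p. p \<in> V \<Longrightarrow> snd s p = \<pi> p" 
      "\<And>x. B + Suc n \<le> x \<Longrightarrow> x < B + Suc n + Suc n \<Longrightarrow> snd s x = 0"
  shows "runs W NW_row s (200 * ((n + 2) * (n + 2))) (\<lambda>s'. loop_state i B s' \<and>
    snd s' = (\<lambda>x. if B + Suc n \<le> x \<and> x < B + Suc n + Suc n then NW_part i 0 (x - (B + Suc n)) else snd s x))"
proof -
  define C where "C = B + Suc n"
  have C: "C + Suc n < W" "n < C" "C = B + Suc n" using B by (auto simp: C_def)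
  define mem_at where
    "mem_at p = (\<lambda>x. if C \<le> x \<and> x < C + Suc n then NW_part i p (x - C) else snd s x)" for p
  define Inv where "Inv k s' \<longleftrightarrow> loop_state i B s' \<and> fst s' 3 = i - k \<and> fst s' 9 = C \<and>
    snd s' = mem_at (i - k)" for k s'
  let ?guard = "Less' (Const 0) (Reg 3)"
  let ?body = "Seq NW_fetch (Seq raise_range (Assign 3 (Sub' (Reg 3) (Const 1))))"
  have "runs W (While ?guard ?body) s0 (Suc i * (1 + expr_cost ?guard + (cost NW_fetch + (20 * Suc n + 4)))) (Inv i)"
    if "Inv 0 s0" for s0
  proof (rule runs_While[where Inv = Inv])
    show "Inv 0 s0" by fact
    show "fits W ?guard s' \<and> expr_val ?guard s' = 0" if "Inv i s'" for s'
      using that C by (auto simp: Inv_def)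
    fix k s1 assume k: "k < i" and inv: "Inv k s1"
    obtain r m where s1: "s1 = (r, m)" by (cases s1)
    define p where "p = i - Suc k"
    have p: "i - k = Suc p" "p < i" "Suc p \<in> V" using k i by (auto simp: p_def)
    define u where "u = \<pi> (Suc p)"
    have u: "u \<in> V" unfolding u_def by (rule perm_in[OF p(3)])
    define t where "t = NW_part i (Suc p) u"
    have t: "t \<le> n" unfolding t_def by (rule part_le)
    have r: "r 0 = n" "r 1 = i" "r 2 = B" "r 3 = Suc p" "r 4 = Suc n" "r 9 = C"
      using inv p by (auto simp: Inv_def loop_state_def s1)
    have m: "m = (\<lambda>x. if C \<le> x \<and> x < C + Suc n then NW_part i (Suc p) (x - C) else snd s x)"
      using inv p by (simp add: Inv_def s1 mem_at_def)
    have mu: "m (Suc p) = u" using mem(1)[OF p(3)] p i C by (simp add: m u_def)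
    have mt: "m (C + u) = t" using u by (simp add: m t_def)
    have mW: "m x < W" if "C \<le> x" "x < C + u" for x
      using that part_le(1)[of i "Suc p" "x - C"] u C by (simp add: m)
    let ?r = "r(8 := u, 5 := t + 1, 6 := 0)"
    have fetch: "effect NW_fetch (r, m) = (?r, m)"
      using r mu mt by (simp add: NW_fetch_def)
    have "safe W NW_fetch (r, m)"
      using r mu mt u t C p i by (simp add: NW_fetch_def)
    moreover have "runs W (Seq raise_range (Assign 3 (Sub' (Reg 3) (Const 1)))) (?r, m)
        (20 * Suc n + 4) (Inv (Suc k))"
    proof (rule runs_Seq)
      have "runs W raise_range (?r, m) (20 * (u + 1)) (\<lambda>s'. s' = (?r(6 := u), mem_at p))"
      proof (rule raise_range_runs_to)
        show "(\<lambda>x. if C + 0 \<le> x \<and> x < C + u then max (m x) (t + 1) else m x) = mem_at p"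
          unfolding u_def t_def mem_at_def by (rule raised_NW_part[OF p(2) i m])
      qed (use r u t C mW in auto)
      then show "runs W raise_range (?r, m) (20 * Suc n) (\<lambda>s'. s' = (?r(6 := u), mem_at p))"
        by (rule runs_weaken) (use u in auto)
      show "runs W (Assign 3 (Sub' (Reg 3) (Const 1))) s' 4 (Inv (Suc k))"
        if "s' = (?r(6 := u), mem_at p)" for s'
        by (rule runs_effect) (use that r p i C in \<open>auto simp: Inv_def loop_state_def p_def\<close>)
    qed
    ultimately have "runs W ?body (r, m) (cost NW_fetch + (20 * Suc n + 4)) (Inv (Suc k))"
      by (intro runs_Seq_effect) (simp_all add: fetch)
    then show "fits W ?guard s1 \<and> expr_val ?guard s1 \<noteq> 0 \<and>
        runs W ?body s1 (cost NW_fetch + (20 * Suc n + 4)) (Inv (Suc k))"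
      using r p i C by (auto simp: s1)
  qed
  moreover have "mem_at i = snd s"
    \<comment> \<open>Zeros are the correct table for an empty range of positions, so fresh memory
      serves as the initial table.\<close>
    using mem(2) unfolding mem_at_def NW_part_init C_def by auto
  then have "Inv 0 (effect NW_init s)"
    using s by (auto simp: NW_init_def Inv_def loop_state_def C_def)
  moreover have "safe W NW_init s" using s i C by (simp add: NW_init_def loop_state_def)
  ultimately have "runs W NW_row s (cost NW_init +
      Suc i * (1 + expr_cost ?guard + (cost NW_fetch + (20 * Suc n + 4)))) (Inv i)"
    unfolding NW_row_def by (intro runs_Seq_effect) auto
  then show ?thesis
    by (rule runs_weaken, intro row_time)
      (use i in \<open>auto simp: NW_init_def NW_fetch_def Inv_def mem_at_def C_def\<close>)
qed

lemma SE_row_runs: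
  assumes s: "loop_state i B s" and i: "i \<le> n" and B: "Suc n \<le> B" "B + 4 * Suc n < W"
    and mem: "\<And>p. p \<in> V \<Longrightarrow> snd s p = \<pi> p" 
      "\<And>x. B + 2 * Suc n \<le> x \<Longrightarrow> x < B + 2 * Suc n + Suc n \<Longrightarrow> snd s x = 0"
  shows "runs W SE_row s (200 * ((n + 2) * (n + 2))) (\<lambda>s'. loop_state i B s' \<and>
    snd s' = (\<lambda>x. if B + 2 * Suc n \<le> x \<and> x < B + 2 * Suc n + Suc n
      then SE_part i n (x - (B + 2 * Suc n)) else snd s x))"
proof -
  define C where "C = B + 2 * Suc n"
  have C: "C + Suc n < W" "n < C" "C = B + 2 * Suc n" using B by (auto simp: C_def)
  define mem_at where
    "mem_at p = (\<lambda>x. if C \<le> x \<and> x < C + Suc n then SE_part i p (x - C) else snd s x)" for p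
  define Inv where "Inv k s' \<longleftrightarrow> loop_state i B s' \<and> fst s' 3 = Suc (i + k) \<and> fst s' 8 = Suc n \<and>
    fst s' 9 = C \<and> snd s' = mem_at (i + k)" for k s'
  let ?guard = "Less' (Reg 3) (Reg 4)"
  let ?body = "Seq SE_fetch (Seq raise_range (Assign 3 (Add' (Reg 3) (Const 1))))"
  have "runs W (While ?guard ?body) s0 (Suc (n - i) * (1 + expr_cost ?guard + (cost SE_fetch + (20 * (Suc n + 1) + 4)))) (Inv (n - i))"
    if "Inv 0 s0" for s0
  proof (rule runs_While[where Inv = Inv])
    show "Inv 0 s0" by fact
    show "fits W ?guard s' \<and> expr_val ?guard s' = 0" if "Inv (n - i) s'" for s'
      using that i C by (auto simp: Inv_def loop_state_def)
    fix k s1 assume k: "k < n - i" and inv: "Inv k s1"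
    obtain r m where s1: "s1 = (r, m)" by (cases s1)
    define p where "p = i + k"
    have p: "i \<le> p" "p < n" "Suc p \<in> V" using k by (auto simp: p_def)
    define u where "u = \<pi> (Suc p)"
    have u: "u \<in> V" unfolding u_def by (rule perm_in[OF p(3)])
    define t where "t = SE_part i p (u - 1)"
    have t: "t \<le> n" unfolding t_def by (rule part_le)
    have r: "r 0 = n" "r 1 = i" "r 2 = B" "r 3 = Suc p" "r 4 = Suc n" "r 8 = Suc n" "r 9 = C"
      using inv by (auto simp: Inv_def loop_state_def s1 p_def)
    have m: "m = (\<lambda>x. if C \<le> x \<and> x < C + Suc n then SE_part i p (x - C) else snd s x)"
      using inv by (simp add: Inv_def s1 mem_at_def flip: p_def)
    have mu: "m (Suc p) = u" using mem(1)[OF p(3)] p C by (simp add: m u_def)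
    have "m (C + b) = SE_part i p b" if "b \<le> n" for b using that by (simp add: m)
    moreover have "C + u - 1 = C + (u - 1)" "u - 1 \<le> n" using u by auto
    ultimately have mt: "m (C + u - 1) = t" unfolding t_def by metis
    have mW: "m x < W" if "C + u \<le> x" "x < C + Suc n" for x
      using that part_le(2)[of i p "x - C"] C by (simp add: m)
    let ?r = "r(6 := u, 5 := t + 1)"
    have fetch: "effect SE_fetch (r, m) = (?r, m)"
      using r mu mt by (simp add: SE_fetch_def)
    have "safe W SE_fetch (r, m)"
      using r mu mt u t C p by (auto simp: SE_fetch_def)
    moreover have "runs W (Seq raise_range (Assign 3 (Add' (Reg 3) (Const 1)))) (?r, m)
        (20 * (Suc n + 1) + 4) (Inv (Suc k))"
    proof (rule runs_Seq)
      show "runs W raise_range (?r, m) (20 * (Suc n + 1)) (\<lambda>s'. s' = (?r(6 := Suc n), mem_at (Suc p)))"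
      proof (rule raise_range_runs_to)
        show "(\<lambda>x. if C + u \<le> x \<and> x < C + Suc n then max (m x) (t + 1) else m x) = mem_at (Suc p)"
          unfolding u_def t_def mem_at_def by (rule raised_SE_part[OF p(1,2) m])
      qed (use r u t C mW in auto)
      show "runs W (Assign 3 (Add' (Reg 3) (Const 1))) s' 4 (Inv (Suc k))"
        if "s' = (?r(6 := Suc n), mem_at (Suc p))" for s'
        by (rule runs_effect) (use that r p i C in \<open>auto simp: Inv_def loop_state_def p_def\<close>)
    qed
    ultimately have "runs W ?body (r, m) (cost SE_fetch + (20 * (Suc n + 1) + 4)) (Inv (Suc k))"
      by (intro runs_Seq_effect) (simp_all add: fetch)
    then show "fits W ?guard s1 \<and> expr_val ?guard s1 \<noteq> 0 \<and>
        runs W ?body s1 (cost SE_fetch + (20 * (Suc n + 1) + 4)) (Inv (Suc k))"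
      using r p C by (auto simp: s1)
  qed
  moreover have "mem_at i = snd s"
    using mem(2) unfolding mem_at_def SE_part_init C_def by auto
  then have "Inv 0 (effect SE_init s)"
    using s by (auto simp: SE_init_def Inv_def loop_state_def C_def)
  moreover have "safe W SE_init s" using s i C by (simp add: SE_init_def loop_state_def)
  ultimately have "runs W SE_row s (cost SE_init +
      Suc (n - i) * (1 + expr_cost ?guard + (cost SE_fetch + (20 * (Suc n + 1) + 4)))) (Inv (n - i))"
    unfolding SE_row_def by (intro runs_Seq_effect) auto
  then show ?thesis
    by (rule runs_weaken, intro row_time)
      (use i in \<open>auto simp: SE_init_def SE_fetch_def Inv_def mem_at_def C_def\<close>)
qed

lemma minimax_row_runs:
  assumes s: "loop_state i B s" and B: "B + 4 * Suc n < W"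
    and prev: "\<And>j. j \<le> n \<Longrightarrow> snd s (B + j) = (if i = 0 then 0 else minimax cut_width (i - 1) j)"
    and NW: "\<And>j. j \<le> n \<Longrightarrow> snd s (B + Suc n + j) = NW_part i 0 j"
    and SE: "\<And>j. j \<le> n \<Longrightarrow> snd s (B + 2 * Suc n + j) = SE_part i n j"
  shows "runs W minimax_row s (200 * ((n + 2) * (n + 2))) (\<lambda>s'. loop_state i B s' \<and>
    fst s' 7 = minimax cut_width i n \<and> fst s' 8 = B + 3 * Suc n \<and>
    snd s' = (\<lambda>x. if B + 3 * Suc n \<le> x \<and> x < B + 3 * Suc n + Suc n
      then minimax cut_width i (x - (B + 3 * Suc n)) else snd s x))"
proof -
  define bNW bSE C where "bNW = B + Suc n" and "bSE = B + 2 * Suc n" and "C = B + 3 * Suc n"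
  have W: "B + n < W" "bNW + n < W" "bSE + n < W" "C + Suc n < W" "B + n < C" "bNW + n < C" "bSE + n < C"
    using B by (auto simp: bNW_def bSE_def C_def)
  define Inv where "Inv k s' \<longleftrightarrow> loop_state i B s' \<and> fst s' 3 = k \<and> fst s' 5 = bNW \<and> fst s' 6 = bSE \<and>
    fst s' 8 = C \<and> fst s' 7 = (if k = 0 then 0 else minimax cut_width i (k - 1)) \<and>
    snd s' = (\<lambda>x. if C \<le> x \<and> x < C + k then minimax cut_width i (x - C) else snd s x)" for k s'
  let ?guard = "Less' (Reg 3) (Reg 4)"
  have "runs W (While ?guard minimax_body) s0
      (Suc (Suc n) * (1 + expr_cost ?guard + cost minimax_body)) (Inv (Suc n))"
    if "Inv 0 s0" for s0
  proof (rule runs_While[where Inv = Inv])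
    show "Inv 0 s0" by fact
    show "fits W ?guard s' \<and> expr_val ?guard s' = 0" if "Inv (Suc n) s'" for s'
      using that W by (auto simp: Inv_def loop_state_def)
    fix k s1 assume "k < Suc n" and inv: "Inv k s1"
    then have k: "k \<le> n" by simp
    obtain r m where s1: "s1 = (r, m)" by (cases s1)
    have r: "r 0 = n" "r 1 = i" "r 2 = B" "r 3 = k" "r 4 = Suc n" "r 5 = bNW" "r 6 = bSE" "r 8 = C"
      using inv by (auto simp: Inv_def loop_state_def s1)
    have m: "m = (\<lambda>x. if C \<le> x \<and> x < C + k then minimax cut_width i (x - C) else snd s x)"
      using inv by (simp add: Inv_def s1)
    define up left d where "up = m (B + k)" and "left = r 7" and "d = minimax cut_width i k"
    have mNW: "m (bNW + k) = NW_part i 0 k" using NW[OF k] W k by (simp add: m bNW_def)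
    have mSE: "m (bSE + k) = SE_part i n k" using SE[OF k] W k by (simp add: m bSE_def)
    have up: "up = (if i = 0 then 0 else minimax cut_width (i - 1) k)"
      using prev[OF k] W k by (simp add: m up_def)
    have left: "left = (if k = 0 then 0 else minimax cut_width i (k - 1))"
      using inv by (simp add: left_def Inv_def s1)
    have d: "d = max (max (NW_part i 0 k) (SE_part i n k)) (min up left)"
      unfolding d_def up left by (subst minimax.simps) (simp only: cut_width_eq)
    have le: "up \<le> n" "left \<le> n" "d \<le> n" "NW_part i 0 k \<le> n" "SE_part i n k \<le> n"
      by (auto simp: up left d_def minimax_cut_width_le part_le)
    have eff: "effect minimax_body (r, m) = (r(7 := d, 3 := Suc k), m(C + k := d))"
      using r mNW mSE up_def left_def d by (auto simp: minimax_body_def fun_eq_iff)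
    have safe: "safe W minimax_body (r, m)"
      using r mNW mSE up_def left_def le W k by (auto simp: minimax_body_def)
    have "m(C + k := d) = (\<lambda>x. if C \<le> x \<and> x < C + Suc k then minimax cut_width i (x - C) else snd s x)"
      by (auto simp: m d_def fun_eq_iff)
    then have "Inv (Suc k) (effect minimax_body (r, m))"
      using r unfolding eff Inv_def loop_state_def by (simp add: d_def)
    then have "runs W minimax_body (r, m) (cost minimax_body) (Inv (Suc k))"
      using safe by (intro runs_effect) auto
    then show "fits W ?guard s1 \<and> expr_val ?guard s1 \<noteq> 0 \<and>
        runs W minimax_body s1 (cost minimax_body) (Inv (Suc k))"
      using r k W by (auto simp: s1)
  qed
  moreover have "Inv 0 (effect minimax_init s)"
    using s by (auto simp: minimax_init_def Inv_def loop_state_def bNW_def bSE_def C_def)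
  moreover have "safe W minimax_init s"
    using s B by (simp add: minimax_init_def loop_state_def)
  ultimately have "runs W minimax_row s (cost minimax_init +
      Suc (Suc n) * (1 + expr_cost ?guard + cost minimax_body)) (Inv (Suc n))"
    unfolding minimax_row_def by (intro runs_Seq_effect) auto
  then show ?thesis
    by (rule runs_weaken, intro row_time)
      (auto simp: minimax_init_def minimax_body_def Inv_def C_def)
qed

section \<open>Memory layout and the complete program\<close>

definition base :: "nat \<Rightarrow> nat" where
  "base i = Suc n * (3 * i + 1)"

lemma base_Suc: "base (Suc i) = base i + 3 * Suc n"
  by (simp add: base_def algebra_simps)

text \<open>The word bound has no constant factor, so \<open>(n + 2) ^ 3\<close> absorbs the 8, and
  a sixth factor gives strictness.\<close>

lemma base_fits:
  assumes "i \<le> n"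
  shows "base i + 4 * Suc n < (n + 2) ^ 6"
proof -
  have "base i + 4 * Suc n = Suc n * (3 * i + 5)" by (simp add: base_def algebra_simps)
  also have "\<dots> \<le> (n + 2) * (8 * (n + 2))" using assms by (intro mult_mono) auto
  also have "\<dots> \<le> (n + 2) * ((n + 2) ^ 3 * (n + 2))"
    using power_mono[of 2 "n + 2" 3] by (intro mult_mono) auto
  also have "\<dots> = (n + 2) ^ 5" by (simp add: power_numeral_reduce)
  also have "\<dots> < (n + 2) ^ 6" by (rule power_strict_increasing) auto
  finally show ?thesis .
qed

lemma tcl_program_runs:
  "runs ((n + 2) ^ 6) tcl_program (perm_input n \<pi>) (1000 * (n + 2) ^ 3) (\<lambda>s'. fst s' 0 = tcl V E)"
proof -
  define W where "W = (n + 2) ^ 6"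
  define M where "M = (n + 2) * (n + 2)"
  \<comment> \<open>The last conjunct keeps the memory past the previous row fresh, so every row
    finds zeroed tables. Register 7 is tracked because it holds the answer after row
    \<open>n\<close>.\<close>
  define Inv where "Inv i s \<longleftrightarrow> loop_state i (base i) s \<and>
    fst s 7 = (if i = 0 then 0 else minimax cut_width (i - 1) n) \<and>
    (\<forall>p\<in>V. snd s p = \<pi> p) \<and>
    (\<forall>j\<le>n. snd s (base i + j) = (if i = 0 then 0 else minimax cut_width (i - 1) j)) \<and>
    (\<forall>x. base i + Suc n \<le> x \<longrightarrow> snd s x = 0)" for i s
  let ?guard = "Less' (Reg 1) (Reg 4)"
  let ?body = "Seq NW_row (Seq SE_row (Seq minimax_row next_row))"
  have nW: "n + 4 < W" using base_fits[of 0] by (simp add: W_def base_def)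
  have loop: "runs W (While ?guard ?body) s0
      (Suc (Suc n) * (1 + expr_cost ?guard + (200 * M + (200 * M + (200 * M + 6))))) (Inv (Suc n))"
    if "Inv 0 s0" for s0
  proof (rule runs_While[where Inv = Inv])
    show "Inv 0 s0" by fact
    show "fits W ?guard s' \<and> expr_val ?guard s' = 0" if "Inv (Suc n) s'" for s'
      using that nW by (auto simp: Inv_def loop_state_def)
    fix i s assume "i < Suc n" and inv: "Inv i s"
    then have i: "i \<le> n" by simp
    define B where "B = base i"
    have B: "Suc n \<le> B" "B + 4 * Suc n < W"
      using base_fits[OF i] by (auto simp: B_def W_def base_def)
    have ls: "loop_state i B s" and mem: "\<And>p. p \<in> V \<Longrightarrow> snd s p = \<pi> p"
      and prev: "\<And>j. j \<le> n \<Longrightarrow> snd s (B + j) = (if i = 0 then 0 else minimax cut_width (i - 1) j)"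
      and zero: "\<And>x. B + Suc n \<le> x \<Longrightarrow> snd s x = 0"
      using inv by (auto simp: Inv_def B_def)
    have "runs W ?body s (200 * M + (200 * M + (200 * M + 6))) (Inv (Suc i))"
    proof (rule runs_Seq)
      show "runs W NW_row s (200 * M) (\<lambda>s'. loop_state i B s' \<and> snd s' =
          (\<lambda>x. if B + Suc n \<le> x \<and> x < B + Suc n + Suc n then NW_part i 0 (x - (B + Suc n)) else snd s x))"
        unfolding M_def by (rule NW_row_runs[OF ls i B mem zero])
      fix s1 assume "loop_state i B s1 \<and> snd s1 =
          (\<lambda>x. if B + Suc n \<le> x \<and> x < B + Suc n + Suc n then NW_part i 0 (x - (B + Suc n)) else snd s x)"
      then have ls1: "loop_state i B s1" and s1: "snd s1 =
          (\<lambda>x. if B + Suc n \<le> x \<and> x < B + Suc n + Suc n then NW_part i 0 (x - (B + Suc n)) else snd s x)"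
        by auto
      have mem1: "snd s1 p = \<pi> p" if "p \<in> V" for p using mem[OF that] that B by (simp add: s1)
      have zero1: "snd s1 x = 0" if "B + 2 * Suc n \<le> x" for x
        using zero that by (simp add: s1)
      show "runs W (Seq SE_row (Seq minimax_row next_row)) s1 (200 * M + (200 * M + 6)) (Inv (Suc i))"
      proof (rule runs_Seq)
        show "runs W SE_row s1 (200 * M) (\<lambda>s'. loop_state i B s' \<and> snd s' =
            (\<lambda>x. if B + 2 * Suc n \<le> x \<and> x < B + 2 * Suc n + Suc n
              then SE_part i n (x - (B + 2 * Suc n)) else snd s1 x))"
          unfolding M_def by (rule SE_row_runs[OF ls1 i B mem1 zero1])
        fix s2 assume "loop_state i B s2 \<and> snd s2 =
            (\<lambda>x. if B + 2 * Suc n \<le> x \<and> x < B + 2 * Suc n + Suc n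
              then SE_part i n (x - (B + 2 * Suc n)) else snd s1 x)"
        then have ls2: "loop_state i B s2" and s2: "snd s2 =
            (\<lambda>x. if B + 2 * Suc n \<le> x \<and> x < B + 2 * Suc n + Suc n
              then SE_part i n (x - (B + 2 * Suc n)) else snd s1 x)"
          by auto
        have mem2: "snd s2 p = \<pi> p" if "p \<in> V" for p using mem1[OF that] that B by (simp add: s2)
        have zero2: "snd s2 x = 0" if "B + 3 * Suc n \<le> x" for x
          using zero1 that by (simp add: s2)
        have prev2: "snd s2 (B + j) = (if i = 0 then 0 else minimax cut_width (i - 1) j)"
          if "j \<le> n" for j using prev[OF that] that by (simp add: s2 s1)
        have NW2: "snd s2 (B + Suc n + j) = NW_part i 0 j" if "j \<le> n" for j
          using that by (simp add: s2 s1)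
        have SE2: "snd s2 (B + 2 * Suc n + j) = SE_part i n j" if "j \<le> n" for j
          using that by (simp add: s2)
        show "runs W (Seq minimax_row next_row) s2 (200 * M + 6) (Inv (Suc i))"
        proof (rule runs_Seq)
          show "runs W minimax_row s2 (200 * M) (\<lambda>s'. loop_state i B s' \<and>
              fst s' 7 = minimax cut_width i n \<and> fst s' 8 = B + 3 * Suc n \<and>
              snd s' = (\<lambda>x. if B + 3 * Suc n \<le> x \<and> x < B + 3 * Suc n + Suc n
                then minimax cut_width i (x - (B + 3 * Suc n)) else snd s2 x))"
            unfolding M_def by (rule minimax_row_runs[OF ls2 B(2) prev2 NW2 SE2])
          fix s3 assume "loop_state i B s3 \<and>
              fst s3 7 = minimax cut_width i n \<and> fst s3 8 = B + 3 * Suc n \<and>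
              snd s3 = (\<lambda>x. if B + 3 * Suc n \<le> x \<and> x < B + 3 * Suc n + Suc n
                then minimax cut_width i (x - (B + 3 * Suc n)) else snd s2 x)"
          then have ls3: "loop_state i B s3" and r3: "fst s3 7 = minimax cut_width i n" "fst s3 8 = B + 3 * Suc n"
            and s3: "snd s3 = (\<lambda>x. if B + 3 * Suc n \<le> x \<and> x < B + 3 * Suc n + Suc n
                then minimax cut_width i (x - (B + 3 * Suc n)) else snd s2 x)"
            by auto
          have mem3: "snd s3 p = \<pi> p" if "p \<in> V" for p using mem2[OF that] that B by (simp add: s3)
          have zero3: "snd s3 x = 0" if "base (Suc i) + Suc n \<le> x" for x
            using zero2 that by (simp add: s3 base_Suc B_def)
          have row3: "snd s3 (base (Suc i) + j) = minimax cut_width i j" if "j \<le> n" for j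
            using that by (simp add: s3 base_Suc B_def)
          show "runs W next_row s3 6 (Inv (Suc i))"
          proof (rule runs_effect)
            show "safe W next_row s3"
              using ls3 r3 B i by (simp add: next_row_def loop_state_def)
            show "cost next_row \<le> 6" by (simp add: next_row_def)
            have "loop_state (Suc i) (base (Suc i)) (effect next_row s3)"
              using ls3 r3 by (simp add: next_row_def loop_state_def base_Suc B_def)
            then show "Inv (Suc i) (effect next_row s3)"
              using r3 mem3 zero3 row3 by (simp add: Inv_def next_row_def)
          qed
        qed
      qed
    qed
    then show "fits W ?guard s \<and> expr_val ?guard s \<noteq> 0 \<and>
        runs W ?body s (200 * M + (200 * M + (200 * M + 6))) (Inv (Suc i))"
      using ls i nW by (simp add: loop_state_def)
  qed
  define init where "init = Seq (Assign 4 (Add' (Reg 0) (Const 1))) (Assign 2 (Reg 4))"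
  have init: "Inv 0 (effect init (perm_input n \<pi>))"
    by (auto simp: Inv_def init_def loop_state_def perm_input_def base_def)
  have "runs W tcl_program (perm_input n \<pi>) (cost init +
      (Suc (Suc n) * (1 + expr_cost ?guard + (200 * M + (200 * M + (200 * M + 6)))) + 2))
      (\<lambda>s'. fst s' 0 = tcl V E)"
    unfolding tcl_program_def init_def[symmetric]
  proof (rule runs_Seq_effect)
    show "safe W init (perm_input n \<pi>)" using nW by (simp add: init_def perm_input_def)
    show "runs W (Seq (While ?guard ?body) (Assign 0 (Reg 7))) (effect init (perm_input n \<pi>))
        (Suc (Suc n) * (1 + expr_cost ?guard + (200 * M + (200 * M + (200 * M + 6)))) + 2)
        (\<lambda>s'. fst s' 0 = tcl V E)"
    proof (rule runs_Seq[OF loop[OF init]])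
      fix s assume "Inv (Suc n) s"
      then have "fst s 7 = minimax cut_width n n" by (simp add: Inv_def)
      moreover have "minimax cut_width n n < W" using minimax_cut_width_le[of n n] nW by simp
      ultimately show "runs W (Assign 0 (Reg 7)) s 2 (\<lambda>s'. fst s' 0 = tcl V E)"
        unfolding tcl_eq_minimax by (intro runs_effect) simp_all
    qed
  qed
  moreover have "cost init + (Suc (Suc n) * (1 + expr_cost ?guard + (200 * M + (200 * M + (200 * M + 6)))) + 2)
      \<le> 1000 * (n + 2) ^ 3"
  proof -
    have "M \<ge> 4" using mult_mono[of 2 "n + 2" 2 "n + 2"] by (simp add: M_def)
    \<comment> \<open>A round costs \<open>600 * M + 10\<close> in total, which
      \<open>M \<ge> 4\<close> brings below \<open>700 * M\<close>.\<close>
    then have "Suc (Suc n) * (1 + expr_cost ?guard + (200 * M + (200 * M + (200 * M + 6))))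
        \<le> (n + 2) * (700 * M)" by (intro mult_mono) auto
    moreover have "cost init + 2 \<le> (n + 2) * (10 * M)"
      using mult_mono[of 1 "n + 2" 40 "10 * M"] \<open>M \<ge> 4\<close> by (simp add: init_def)
    moreover have "(n + 2) ^ 3 = (n + 2) * M" by (simp add: M_def power3_eq_cube algebra_simps)
    ultimately show ?thesis by (simp add: algebra_simps)
  qed
  ultimately show ?thesis unfolding W_def by (rule runs_weaken)
qed

end

text \<open>For \<open>n \<ge> 3\<close> the logarithm is at least 1, and
  \<open>n + 2 \<le> 3 * n\<close> contributes the factor 27.\<close>

lemma cube_plus_2_bigo: "(\<lambda>n. real (1000 * (n + 2) ^ 3)) \<in> O(\<lambda>n. real n ^ 3 * ln (real n))"
proof (rule bigoI)
  show "\<forall>\<^sub>F n in sequentially. norm (real (1000 * (n + 2) ^ 3)) \<le> 27000 * norm (real n ^ 3 * ln (real n))"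
    using eventually_ge_at_top[of 3]
  proof eventually_elim
    case (elim n)
    have "exp 1 \<le> real n" using exp_le elim by linarith
    then have ln: "1 \<le> ln (real n)" using elim by (subst ln_ge_iff) auto
    have "real (n + 2) ^ 3 \<le> (3 * real n) ^ 3" using elim by (intro power_mono) auto
    also have "\<dots> = 27 * real n ^ 3" by (simp add: power_mult_distrib)
    also have "\<dots> \<le> 27 * (real n ^ 3 * ln (real n))"
      using ln mult_left_mono[of 1 "ln (real n)" "real n ^ 3"] by simp
    finally show ?case using ln by (simp add: mult.commute)
  qed
qed

theorem theorem15:
  shows "\<exists>(P :: com) (T :: nat \<Rightarrow> nat).
    computes_within P (\<lambda>n \<pi>. tcl {1..n} (perm_graph_edges n \<pi>)) T \<and>
    (\<lambda>n. real (T n)) \<in> O(\<lambda>n. real n ^ 3 * ln (real n))"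
proof (intro exI conjI)
  show "computes_within tcl_program (\<lambda>n \<pi>. tcl {1..n} (perm_graph_edges n \<pi>))
      (\<lambda>n. 1000 * (n + 2) ^ 3)"
    unfolding computes_within_def
  proof (rule exI[of _ 6], intro allI impI)
    fix n :: nat and \<pi> assume "\<pi> permutes {1..n}"
    then interpret perm_graph n \<pi> by unfold_locales
    show "\<exists>t s. exec ((n + 2) ^ 6) tcl_program (perm_input n \<pi>) t s \<and> t \<le> 1000 * (n + 2) ^ 3 \<and>
        fst s 0 = tcl {1..n} (perm_graph_edges n \<pi>)"
      using tcl_program_runs unfolding runs_def .
  qed
qed (rule cube_plus_2_bigo)

end
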